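(* Let $(K,\sigma,D)$ be a model of $DCFA$ and let $\mathcal C=\{x\in K: Dx=0\}$ be its field of constants. Then $(\mathcal C,\sigma)$ (with $\sigma$ restricted to $\mathcal C$) is a model of $ACFA$.
   Context: All fields have characteristic $0$. A difference-differential field is a field $K$ with a derivation $D$ and a field automorphism $\sigma$ commuting with $D$; the language is $\mathcal L_{\sigma,D}=\{0,1,+,-,\cdot,\sigma,D\}$. $DCFA$ is the model companion of the theory of difference-differential fields of characteristic $0$ (its models are the existentially closed difference-differential fields). $ACFA$ is the model companion of the theory of difference fields (fields with an automorphism $\sigma$), i.e. the theory of algebraically closed fields with a generic automorphism. *)

theory Defs
  imports "HOL-Algebra.QuotRing"
begin

locale field_char_zero = field K for K (structure) +
  assumes char_zero: "n > (0::nat) \<Longrightarrow> add_pow K n \<one> \<noteq> \<zero>"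

locale difference_field = field_char_zero K for K (structure) +
  fixes \<sigma> :: "'a \<Rightarrow> 'a"
  assumes automorphism: "\<sigma> \<in> ring_iso K K"

locale difference_differential_field = difference_field K \<sigma> for K (structure) and \<sigma> +
  fixes D :: "'a \<Rightarrow> 'a"
  assumes D_closed: "x \<in> carrier K \<Longrightarrow> D x \<in> carrier K"
    and D_add: "\<lbrakk>x \<in> carrier K; y \<in> carrier K\<rbrakk> \<Longrightarrow> D (x \<oplus> y) = D x \<oplus> D y"
    and D_mult: "\<lbrakk>x \<in> carrier K; y \<in> carrier K\<rbrakk> \<Longrightarrow> D (x \<otimes> y) = (D x \<otimes> y) \<oplus> (x \<otimes> D y)"
    and D_commute: "x \<in> carrier K \<Longrightarrow> D (\<sigma> x) = \<sigma> (D x)"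

definition constant_field :: "'a ring \<Rightarrow> ('a \<Rightarrow> 'a) \<Rightarrow> 'a ring" where
  "constant_field K D = K\<lparr>carrier := {x \<in> carrier K. D x = \<zero>\<^bsub>K\<^esub>}\<rparr>"

(* Quantifier-free formulas of the language of rings {0,1,+,-,.} enriched by a set 'u of
   unary function symbols, with variables from 'v. *)

datatype ('u, 'v) tm =
    Var 'v
  | Zero
  | One
  | Add "('u, 'v) tm" "('u, 'v) tm"
  | Minus "('u, 'v) tm" "('u, 'v) tm"
  | Mult "('u, 'v) tm" "('u, 'v) tm"
  | Op 'u "('u, 'v) tm"

datatype ('u, 'v) qf =
    Equal "('u, 'v) tm" "('u, 'v) tm"
  | Neg "('u, 'v) qf"
  | Conj "('u, 'v) qf" "('u, 'v) qf"

datatype difference_symbol = Sigma_sym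

datatype difference_differential_symbol = DD_Sigma_sym | DD_D_sym

primrec tm_val :: "'a ring \<Rightarrow> ('u \<Rightarrow> 'a \<Rightarrow> 'a) \<Rightarrow> ('v \<Rightarrow> 'a) \<Rightarrow> ('u, 'v) tm \<Rightarrow> 'a" where
  "tm_val R I e (Var x) = e x"
| "tm_val R I e Zero = \<zero>\<^bsub>R\<^esub>"
| "tm_val R I e One = \<one>\<^bsub>R\<^esub>"
| "tm_val R I e (Add s t) = tm_val R I e s \<oplus>\<^bsub>R\<^esub> tm_val R I e t"
| "tm_val R I e (Minus s t) = tm_val R I e s \<ominus>\<^bsub>R\<^esub> tm_val R I e t"
| "tm_val R I e (Mult s t) = tm_val R I e s \<otimes>\<^bsub>R\<^esub> tm_val R I e t"
| "tm_val R I e (Op u t) = I u (tm_val R I e t)"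

primrec qf_sat :: "'a ring \<Rightarrow> ('u \<Rightarrow> 'a \<Rightarrow> 'a) \<Rightarrow> ('v \<Rightarrow> 'a) \<Rightarrow> ('u, 'v) qf \<Rightarrow> bool" where
  "qf_sat R I e (Equal s t) \<longleftrightarrow> tm_val R I e s = tm_val R I e t"
| "qf_sat R I e (Neg \<phi>) \<longleftrightarrow> \<not> qf_sat R I e \<phi>"
| "qf_sat R I e (Conj \<phi> \<psi>) \<longleftrightarrow> qf_sat R I e \<phi> \<and> qf_sat R I e \<psi>"

(* Injectivity is automatic: a unital homomorphism between fields is injective. *)

definition op_embedding ::
    "'a ring \<Rightarrow> ('u \<Rightarrow> 'a \<Rightarrow> 'a) \<Rightarrow> 'b ring \<Rightarrow> ('u \<Rightarrow> 'b \<Rightarrow> 'b) \<Rightarrow> ('a \<Rightarrow> 'b) \<Rightarrow> bool" where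
  "op_embedding R I S J h \<longleftrightarrow>
     h \<in> ring_hom R S \<and> (\<forall>u. \<forall>x \<in> carrier R. h (I u x) = J u (h x))"

(* R is existentially closed in its extension h : R -> S: every existential formula with
   parameters a in R that holds in S holds in R.  Variables Inl i stand for parameters, variables
   Inr j are existentially quantified; only finitely many of them occur in a given formula. *)

definition ec_in ::
    "'a ring \<Rightarrow> ('u \<Rightarrow> 'a \<Rightarrow> 'a) \<Rightarrow> 'b ring \<Rightarrow> ('u \<Rightarrow> 'b \<Rightarrow> 'b) \<Rightarrow> ('a \<Rightarrow> 'b) \<Rightarrow> bool" where
  "ec_in R I S J h \<longleftrightarrow>
     (\<forall>(\<phi> :: ('u, nat + nat) qf) (a :: nat \<Rightarrow> 'a).
        range a \<subseteq> carrier R \<longrightarrow>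
        (\<exists>b. range b \<subseteq> carrier S \<and> qf_sat S J (case_sum (h \<circ> a) b) \<phi>) \<longrightarrow>
        (\<exists>c. range c \<subseteq> carrier R \<and> qf_sat R I (case_sum a c) \<phi>))"

(* The models of DCFA and of ACFA (in characteristic 0) are the existentially closed
   difference-differential fields, respectively the existentially closed difference fields.

   HOL cannot quantify over types inside a definition, so the type 'b in which extensions live
   is a parameter.  For a model on the type 'a, the instance 'b = 'a already gives
   existential closedness in extensions on all types: a solution in an extension lies in the
   sub-(differential-)difference field generated by it over the image of the infinite field K
   (closed under the automorphism, its inverse and the derivation), which has the cardinality
   of K and hence a copy on the type 'a.  A smaller 'b may make the condition vacuous. *)

definition DCFA_model :: "'b itself \<Rightarrow> 'a ring \<Rightarrow> ('a \<Rightarrow> 'a) \<Rightarrow> ('a \<Rightarrow> 'a) \<Rightarrow> bool" where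
  "DCFA_model U K \<sigma> D \<longleftrightarrow>
     difference_differential_field K \<sigma> D \<and>
     (\<forall>(L :: 'b ring) \<tau> E h.
        difference_differential_field L \<tau> E \<longrightarrow>
        op_embedding K (case_difference_differential_symbol \<sigma> D)
                     L (case_difference_differential_symbol \<tau> E) h \<longrightarrow>
        ec_in K (case_difference_differential_symbol \<sigma> D)
              L (case_difference_differential_symbol \<tau> E) h)"

definition ACFA_model :: "'b itself \<Rightarrow> 'a ring \<Rightarrow> ('a \<Rightarrow> 'a) \<Rightarrow> bool" where
  "ACFA_model U K \<sigma> \<longleftrightarrow>
     difference_field K \<sigma> \<and>
     (\<forall>(L :: 'b ring) \<tau> h.
        difference_field L \<tau> \<longrightarrow>
        op_embedding K (case_difference_symbol \<sigma>) L (case_difference_symbol \<tau>) h \<longrightarrow>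
        ec_in K (case_difference_symbol \<sigma>) L (case_difference_symbol \<tau>) h)"

end

theory Submission
  imports Defs "HOL-Algebra.Subrings" "HOL-Algebra.Weak_Morphisms"
begin

text \<open>Let \<open>C\<close> be the constant field of \<open>K\<close> and \<open>L\<close> a difference field extension of \<open>C\<close>. Give
  \<open>K \<otimes>\<^sub>C L\<close> the derivation \<open>D \<otimes> 0\<close> and the automorphism \<open>\<sigma> \<otimes> \<tau>\<close>. Since elements of \<open>L\<close> that are
  linearly independent over \<open>C\<close> stay independent over \<open>K\<close>, this ring has no proper nonzero
  differential ideal, and a differentially simple ring of characteristic zero is a domain. Its
  fraction field is therefore a difference-differential extension of \<open>K\<close> containing \<open>L\<close> among its
  constants, so a formula solvable in \<open>L\<close> is solvable in \<open>K\<close> together with the equations \<open>D x = 0\<close>.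

  The tensor product is realised as a ring of operators on the space \<open>V\<close> of \<open>C\<close>-linear maps
  \<open>f : K \<rightarrow> L\<close>, where \<open>k \<otimes> l\<close> sends \<open>f\<close> to \<open>x \<mapsto> l f(k x)\<close>. Derivation and automorphism are then
  induced by a commutator and a conjugation, so they need no check of well-definedness.\<close>

section \<open>Differentially simple rings\<close>

text \<open>Two obstacles shape the argument. The hypothesis on K speaks only of extensions whose
  elements have the type of K, whereas the compositum lives on a type of sets of pairs of operators.
  A downward Loewenheim-Skolem argument bridges the gap, and it also lets L have elements of any
  type. The other obstacle is to see that the tensor product is a nonzero domain. Classically this
  holds because the constants are relatively algebraically closed in K, so that K is a regular
  extension of C; differential simplicity gives it with no more than inverses and repeated
  differentiation. The space V is the L-linear dual of the tensor product, restricted to K, and the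
  operators are the image of the tensor product under its action on this dual. Simplicity is proved
  for the image itself, so faithfulness of the action never has to be discussed. The image is
  nonzero because some C-linear map from K to L sends 1 to 1.\<close>

locale differential_ring = cring R for R (structure) +
  fixes \<delta> :: "'a \<Rightarrow> 'a"
  assumes d_closed: "x \<in> carrier R \<Longrightarrow> \<delta> x \<in> carrier R"
    and d_add: "\<lbrakk>x \<in> carrier R; y \<in> carrier R\<rbrakk> \<Longrightarrow> \<delta> (x \<oplus> y) = \<delta> x \<oplus> \<delta> y"
    and d_mult: "\<lbrakk>x \<in> carrier R; y \<in> carrier R\<rbrakk> \<Longrightarrow> \<delta> (x \<otimes> y) = (\<delta> x \<otimes> y) \<oplus> (x \<otimes> \<delta> y)"
begin

lemma d_zero: "\<delta> \<zero> = \<zero>"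
  by (metis add.l_cancel_one' d_add d_closed r_zero zero_closed)

lemma d_one: "\<delta> \<one> = \<zero>"
proof -
  have "\<delta> \<one> = \<delta> \<one> \<oplus> \<delta> \<one>"
    using d_mult[of \<one> \<one>] d_closed[of \<one>] by simp
  then show ?thesis
    by (metis add.l_cancel_one' d_closed one_closed)
qed

lemma d_minus: "x \<in> carrier R \<Longrightarrow> \<delta> (\<ominus> x) = \<ominus> \<delta> x"
  by (metis a_inv_closed d_add d_closed d_zero l_neg minus_equality)

lemma d_power:
  assumes a: "a \<in> carrier R"
  shows "\<delta> (a [^] Suc n) = [Suc n] \<cdot> (a [^] n \<otimes> \<delta> a)"
proof (induction n)
  case 0
  then show ?case using a by (simp add: d_closed d_one)
next
  case (Suc n)
  have "\<delta> (a [^] Suc (Suc n)) = \<delta> (a [^] Suc n) \<otimes> a \<oplus> a [^] Suc n \<otimes> \<delta> a"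
    using a d_mult[of "a [^] Suc n" a] by simp
  also have "\<delta> (a [^] Suc n) \<otimes> a = [Suc n] \<cdot> ((a [^] n \<otimes> \<delta> a) \<otimes> a)"
    unfolding Suc.IH by (rule add_pow_ldistr) (use a d_closed in auto)
  also have "(a [^] n \<otimes> \<delta> a) \<otimes> a = a [^] Suc n \<otimes> \<delta> a"
    using a d_closed by (simp add: m_ac)
  finally show ?case
    using a d_closed by simp
qed

text \<open>Two classical steps: for non-nilpotent \<open>a\<close> the elements annihilated by a power of \<open>a\<close> form
  a differential ideal, so zero divisors are nilpotent; then, in characteristic zero, the
  nilradical is a differential ideal as well.\<close>

lemma domain_of_simple:
  assumes one: "\<one> \<noteq> \<zero>"
    and simple: "\<And>I. \<lbrakk>ideal I R; \<And>x. x \<in> I \<Longrightarrow> \<delta> x \<in> I; \<one> \<notin> I\<rbrakk> \<Longrightarrow> I \<subseteq> {\<zero>}"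
    and char0: "\<And>n x. \<lbrakk>x \<in> carrier R; [Suc n] \<cdot> x = \<zero>\<rbrakk> \<Longrightarrow> x = \<zero>"
  shows "domain R"
proof -
  have ideal_if: "ideal I R" if sub: "I \<subseteq> carrier R" and z: "\<zero> \<in> I"
    and ad: "\<And>x y. \<lbrakk>x \<in> I; y \<in> I\<rbrakk> \<Longrightarrow> x \<oplus> y \<in> I"
    and mu: "\<And>x y. \<lbrakk>x \<in> I; y \<in> carrier R\<rbrakk> \<Longrightarrow> y \<otimes> x \<in> I" for I
  proof (rule idealI)
    show "ring R" by (rule ring_axioms)
    show "subgroup I (add_monoid R)"
    proof (rule add.subgroupI)
      fix a assume a: "a \<in> I"
      then have "\<ominus> a = (\<ominus> \<one>) \<otimes> a" using sub by (simp add: subset_iff l_minus)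
      then show "\<ominus> a \<in> I" using mu[OF a, of "\<ominus> \<one>"] by simp
    qed (use sub z ad in auto)
    fix a x assume "a \<in> I" "x \<in> carrier R"
    then show "x \<otimes> a \<in> I" "a \<otimes> x \<in> I"
      using mu[of a x] m_comm[of a x] sub by auto
  qed
  have nil: "\<exists>n::nat. a [^] n = \<zero>"
    if a: "a \<in> carrier R" and b: "b \<in> carrier R" "b \<noteq> \<zero>" "a \<otimes> b = \<zero>" for a b
  proof -
    define I where "I = {x \<in> carrier R. \<exists>n::nat. a [^] n \<otimes> x = \<zero>}"
    have shift: "a [^] (n + m) \<otimes> x = \<zero>" if "a [^] n \<otimes> x = \<zero>" "x \<in> carrier R" for n m :: nat and x
    proof -
      have "a [^] (n + m) \<otimes> x = a [^] m \<otimes> (a [^] n \<otimes> x)"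
        using a that(2) by (simp add: nat_pow_mult[symmetric] m_ac)
      then show ?thesis using that a by simp
    qed
    have "ideal I R"
    proof (rule ideal_if)
      show "I \<subseteq> carrier R" by (auto simp: I_def)
      show "\<zero> \<in> I" using a by (auto simp: I_def)
      fix x assume x: "x \<in> I"
      then obtain n :: nat where n: "a [^] n \<otimes> x = \<zero>" "x \<in> carrier R" by (auto simp: I_def)
      { fix y assume "y \<in> I"
        then obtain m :: nat where m: "a [^] m \<otimes> y = \<zero>" "y \<in> carrier R" by (auto simp: I_def)
        have "a [^] (n + m) \<otimes> (x \<oplus> y) = a [^] (n + m) \<otimes> x \<oplus> a [^] (m + n) \<otimes> y"
          using a n m by (simp add: r_distr add.commute)
        then have "a [^] (n + m) \<otimes> (x \<oplus> y) = \<zero>"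
          using shift[OF n, of m] shift[OF m, of n] by simp
        then show "x \<oplus> y \<in> I" using n m by (auto simp: I_def) }
      { fix y assume y: "y \<in> carrier R"
        have "a [^] n \<otimes> (y \<otimes> x) = y \<otimes> (a [^] n \<otimes> x)" using a n(2) y by (simp add: m_ac)
        then have "a [^] n \<otimes> (y \<otimes> x) = \<zero>" using n y by simp
        then show "y \<otimes> x \<in> I" using n y unfolding I_def by blast }
    qed
    moreover have "\<delta> x \<in> I" if "x \<in> I" for x
    proof -
      from that obtain n :: nat where n: "a [^] n \<otimes> x = \<zero>" "x \<in> carrier R" by (auto simp: I_def)
      \<comment> \<open>The exponent is raised by one because differentiating
        \<open>a [^] Suc n \<otimes> x = \<zero>\<close> leaves a first summand that still contains
        the factor \<open>a [^] n \<otimes> x\<close>, which vanishes.\<close>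
      have n1: "a [^] Suc n \<otimes> x = \<zero>" using shift[OF n, of 1] by simp
      then have "\<zero> = \<delta> (a [^] Suc n) \<otimes> x \<oplus> a [^] Suc n \<otimes> \<delta> x"
        using d_mult[of "a [^] Suc n" x] a n d_zero by simp
      also have "\<delta> (a [^] Suc n) \<otimes> x = [Suc n] \<cdot> ((a [^] n \<otimes> \<delta> a) \<otimes> x)"
        unfolding d_power[OF a] by (rule add_pow_ldistr) (use a n d_closed in auto)
      also have "(a [^] n \<otimes> \<delta> a) \<otimes> x = \<delta> a \<otimes> (a [^] n \<otimes> x)"
        using a n(2) d_closed by (simp add: m_ac)
      finally have "a [^] Suc n \<otimes> \<delta> x = \<zero>"
        using a n d_closed by simp
      then show ?thesis using n d_closed unfolding I_def by blast
    qed
    \<comment> \<open>The given zero divisor makes the ideal nonzero, so simplicity forces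
      \<open>\<one>\<close> into it, and this says that a power of \<open>a\<close> is zero.\<close>
    moreover have "b \<in> I" using a b unfolding I_def by (auto intro!: exI[of _ "1::nat"])
    ultimately have "\<one> \<in> I" using simple b by blast
    then show ?thesis using a by (auto simp: I_def)
  qed
  define N where "N = {x \<in> carrier R. \<exists>n::nat. x [^] n = \<zero>}"
  \<comment> \<open>With the least exponent, a nilpotent element comes with a nonzero power of
    itself that it annihilates. This is the form in which \<open>nil\<close> can be applied
    again.\<close>
  have least: "\<exists>n. a [^] Suc n = \<zero> \<and> a [^] n \<noteq> \<zero>" if "a [^] m = \<zero>" for a and m :: nat
    using that by (induction m) (use one in auto)
  have "ideal N R"
  proof (rule ideal_if)
    show "N \<subseteq> carrier R" by (auto simp: N_def)
    show "\<zero> \<in> N" by (auto simp: N_def intro!: exI[of _ "1::nat"])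
    fix x assume x: "x \<in> N"
    then obtain k :: nat where k: "x [^] k = \<zero>" "x \<in> carrier R" by (auto simp: N_def)
    then obtain n where n: "x [^] Suc n = \<zero>" "x [^] n \<noteq> \<zero>" using least by blast
    { fix y assume "y \<in> N"
      then obtain m :: nat where m: "y [^] m = \<zero>" "y \<in> carrier R" by (auto simp: N_def)
      \<comment> \<open>Multiplication by \<open>x [^] n\<close> kills \<open>x\<close>, so it
        cannot distinguish \<open>x \<oplus> y\<close> from \<open>y\<close>. Hence a power of
        \<open>x \<oplus> y\<close> annihilates the nonzero element \<open>x [^] n\<close> and is
        nilpotent by \<open>nil\<close>; no binomial expansion is involved.\<close>
      have pow: "x [^] n \<otimes> (x \<oplus> y) [^] i = x [^] n \<otimes> y [^] i" for i :: nat
      proof (induction i)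
        case (Suc i)
        have "x [^] n \<otimes> (x \<oplus> y) [^] Suc i = (x [^] n \<otimes> y [^] i) \<otimes> (x \<oplus> y)"
          using k m by (simp add: Suc.IH[symmetric] m_assoc)
        also have "\<dots> = x [^] Suc n \<otimes> y [^] i \<oplus> x [^] n \<otimes> y [^] Suc i"
          using k m by (simp add: r_distr m_ac)
        finally show ?case using n k m by simp
      qed (use k m in simp)
      have "\<exists>j::nat. (x \<oplus> y) [^] j = \<zero>"
      proof (cases m)
        case 0
        then show ?thesis using m one by simp
      next
        case (Suc m')
        have "(x \<oplus> y) [^] m \<otimes> x [^] n = \<zero>"
          using pow[of m] k m by (simp add: m_comm)
        then obtain j :: nat where "((x \<oplus> y) [^] m) [^] j = \<zero>"
          using nil[of "(x \<oplus> y) [^] m" "x [^] n"] k m n by auto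
        then show ?thesis using k m by (auto simp: nat_pow_pow)
      qed
      then show "x \<oplus> y \<in> N" using k m by (simp add: N_def) }
    { fix y assume y: "y \<in> carrier R"
      have "(y \<otimes> x) [^] k = \<zero>" using k y by (simp add: nat_pow_distrib)
      then show "y \<otimes> x \<in> N" using k y unfolding N_def by blast }
  qed
  moreover have "\<delta> x \<in> N" if "x \<in> N" for x
  proof -
    from that obtain n where n: "x [^] Suc n = \<zero>" "x [^] n \<noteq> \<zero>" "x \<in> carrier R"
      using least unfolding N_def by blast
    \<comment> \<open>This is the derivative of \<open>x [^] Suc n = \<zero>\<close>. Characteristic
      zero removes the factor, after which \<open>\<delta> x\<close> annihilates the nonzero
      \<open>x [^] n\<close>.\<close>
    have "[Suc n] \<cdot> (x [^] n \<otimes> \<delta> x) = \<zero>"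
      using d_power[OF n(3), of n] n(1) d_zero by simp
    then have "\<delta> x \<otimes> x [^] n = \<zero>"
      using char0[of "x [^] n \<otimes> \<delta> x" n] n d_closed m_comm by simp
    then show ?thesis using nil[of "\<delta> x" "x [^] n"] n d_closed by (auto simp: N_def)
  qed
  moreover have "\<one> \<notin> N" using one by (auto simp: N_def)
  ultimately have N0: "N \<subseteq> {\<zero>}" using simple by blast
  show ?thesis
  proof unfold_locales
    show "\<one> \<noteq> \<zero>" by (rule one)
    fix a b assume "a \<otimes> b = \<zero>" "a \<in> carrier R" "b \<in> carrier R"
    then show "a = \<zero> \<or> b = \<zero>" using nil N0 unfolding N_def by blast
  qed
qed

end

section \<open>Fraction fields\<close>

text \<open>Fractions are whole classes of pairs, so that equal fractions are equal in HOL. The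
  operations are defined through a chosen representative, and the lemmas below show that any
  representative may be used instead.\<close>

definition ring_frac :: "('a, 'm) ring_scheme \<Rightarrow> 'a \<Rightarrow> 'a \<Rightarrow> ('a \<times> 'a) set" where
  "ring_frac R a b = {(c, d). c \<in> carrier R \<and> d \<in> carrier R - {\<zero>\<^bsub>R\<^esub>} \<and> a \<otimes>\<^bsub>R\<^esub> d = c \<otimes>\<^bsub>R\<^esub> b}"

definition num :: "('a \<times> 'a) set \<Rightarrow> 'a" where
  "num X = fst (SOME p. p \<in> X)"

definition den :: "('a \<times> 'a) set \<Rightarrow> 'a" where
  "den X = snd (SOME p. p \<in> X)"

definition fraction_field :: "('a, 'm) ring_scheme \<Rightarrow> ('a \<times> 'a) set ring" where
  "fraction_field R =
    \<lparr>carrier = {ring_frac R a b | a b. a \<in> carrier R \<and> b \<in> carrier R - {\<zero>\<^bsub>R\<^esub>}},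
     mult = (\<lambda>X Y. ring_frac R (num X \<otimes>\<^bsub>R\<^esub> num Y) (den X \<otimes>\<^bsub>R\<^esub> den Y)),
     one = ring_frac R \<one>\<^bsub>R\<^esub> \<one>\<^bsub>R\<^esub>,
     zero = ring_frac R \<zero>\<^bsub>R\<^esub> \<one>\<^bsub>R\<^esub>,
     add = (\<lambda>X Y. ring_frac R (num X \<otimes>\<^bsub>R\<^esub> den Y \<oplus>\<^bsub>R\<^esub> num Y \<otimes>\<^bsub>R\<^esub> den X) (den X \<otimes>\<^bsub>R\<^esub> den Y))\<rparr>"

context "domain"
begin

lemma frac_eq_iff:
  assumes "a \<in> carrier R" "b \<in> carrier R - {\<zero>}" "c \<in> carrier R" "d \<in> carrier R - {\<zero>}"
  shows "ring_frac R a b = ring_frac R c d \<longleftrightarrow> a \<otimes> d = c \<otimes> b"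
proof
  assume "ring_frac R a b = ring_frac R c d"
  moreover have "(c, d) \<in> ring_frac R c d" using assms by (simp add: ring_frac_def)
  ultimately show "a \<otimes> d = c \<otimes> b" by (auto simp: ring_frac_def)
next
  assume eq: "a \<otimes> d = c \<otimes> b"
  \<comment> \<open>Transitivity of cross multiplication: multiply by \<open>d\<close>, use the
    given equation, cancel \<open>b\<close>. Both cancellations rest on the absence of zero
    divisors.\<close>
  have "a \<otimes> y = x \<otimes> b \<longleftrightarrow> c \<otimes> y = x \<otimes> d" if x: "x \<in> carrier R" and y: "y \<in> carrier R" for x y
  proof -
    have "a \<otimes> y = x \<otimes> b \<longleftrightarrow> d \<otimes> (a \<otimes> y) = d \<otimes> (x \<otimes> b)"
      using m_lcancel[of d "a \<otimes> y" "x \<otimes> b"] assms x y by simp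
    also have "d \<otimes> (a \<otimes> y) = (a \<otimes> d) \<otimes> y" using assms x y by (simp add: m_ac)
    also have "\<dots> = b \<otimes> (c \<otimes> y)" unfolding eq using assms x y by (simp add: m_ac)
    also have "d \<otimes> (x \<otimes> b) = b \<otimes> (x \<otimes> d)" using assms x y by (simp add: m_ac)
    also have "b \<otimes> (c \<otimes> y) = b \<otimes> (x \<otimes> d) \<longleftrightarrow> c \<otimes> y = x \<otimes> d"
      using m_lcancel[of b "c \<otimes> y" "x \<otimes> d"] assms x y by simp
    finally show ?thesis .
  qed
  then show "ring_frac R a b = ring_frac R c d" unfolding ring_frac_def by auto
qed

lemma frac_in: "\<lbrakk>a \<in> carrier R; b \<in> carrier R - {\<zero>}\<rbrakk> \<Longrightarrow> ring_frac R a b \<in> carrier (fraction_field R)"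
  by (auto simp: fraction_field_def)

lemma frac_cases:
  assumes "X \<in> carrier (fraction_field R)"
  obtains a b where "a \<in> carrier R" "b \<in> carrier R" "b \<noteq> \<zero>" "X = ring_frac R a b"
  using assms by (auto simp: fraction_field_def)

lemma num_den:
  assumes "a \<in> carrier R" "b \<in> carrier R" "b \<noteq> \<zero>"
  shows "num (ring_frac R a b) \<in> carrier R" "den (ring_frac R a b) \<in> carrier R" "den (ring_frac R a b) \<noteq> \<zero>"
    "a \<otimes> den (ring_frac R a b) = num (ring_frac R a b) \<otimes> b"
proof -
  have "(a, b) \<in> ring_frac R a b" using assms by (simp add: ring_frac_def)
  then have "(SOME p. p \<in> ring_frac R a b) \<in> ring_frac R a b" by (rule someI)
  then show "num (ring_frac R a b) \<in> carrier R" "den (ring_frac R a b) \<in> carrier R" "den (ring_frac R a b) \<noteq> \<zero>"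
    "a \<otimes> den (ring_frac R a b) = num (ring_frac R a b) \<otimes> b"
    unfolding num_def den_def ring_frac_def by auto
qed

lemma fraction_mult:
  assumes a: "a \<in> carrier R" "b \<in> carrier R" "b \<noteq> \<zero>" and c: "c \<in> carrier R" "d \<in> carrier R" "d \<noteq> \<zero>"
  shows "ring_frac R a b \<otimes>\<^bsub>fraction_field R\<^esub> ring_frac R c d = ring_frac R (a \<otimes> c) (b \<otimes> d)"
proof -
  let ?n = "num (ring_frac R a b)" and ?m = "den (ring_frac R a b)"
  let ?n' = "num (ring_frac R c d)" and ?m' = "den (ring_frac R c d)"
  note A = num_den[OF a] and C = num_den[OF c]
  have "(?n \<otimes> ?n') \<otimes> (b \<otimes> d) = (?n \<otimes> b) \<otimes> (?n' \<otimes> d)"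
    using a c A(1-3) C(1-3) by (simp add: m_ac)
  also have "\<dots> = (a \<otimes> ?m) \<otimes> (c \<otimes> ?m')" by (simp only: A(4) C(4))
  also have "\<dots> = (a \<otimes> c) \<otimes> (?m \<otimes> ?m')"
    using a c A(1-3) C(1-3) by (simp add: m_ac)
  finally show ?thesis
    using a c A(1-3) C(1-3) by (simp add: fraction_field_def frac_eq_iff integral_iff)
qed

lemma fraction_add:
  assumes a: "a \<in> carrier R" "b \<in> carrier R" "b \<noteq> \<zero>" and c: "c \<in> carrier R" "d \<in> carrier R" "d \<noteq> \<zero>"
  shows "ring_frac R a b \<oplus>\<^bsub>fraction_field R\<^esub> ring_frac R c d = ring_frac R (a \<otimes> d \<oplus> c \<otimes> b) (b \<otimes> d)"
proof -
  let ?n = "num (ring_frac R a b)" and ?m = "den (ring_frac R a b)"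
  let ?n' = "num (ring_frac R c d)" and ?m' = "den (ring_frac R c d)"
  note A = num_den[OF a] and C = num_den[OF c]
  have "(?n \<otimes> ?m' \<oplus> ?n' \<otimes> ?m) \<otimes> (b \<otimes> d) = (?n \<otimes> b) \<otimes> (?m' \<otimes> d) \<oplus> (?n' \<otimes> d) \<otimes> (?m \<otimes> b)"
    using a c A(1-3) C(1-3) by (simp add: l_distr r_distr m_ac)
  also have "\<dots> = (a \<otimes> ?m) \<otimes> (?m' \<otimes> d) \<oplus> (c \<otimes> ?m') \<otimes> (?m \<otimes> b)" by (simp only: A(4) C(4))
  also have "\<dots> = (a \<otimes> d \<oplus> c \<otimes> b) \<otimes> (?m \<otimes> ?m')"
    using a c A(1-3) C(1-3) by (simp add: l_distr r_distr m_ac)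
  finally show ?thesis
    using a c A(1-3) C(1-3) by (simp add: fraction_field_def frac_eq_iff integral_iff)
qed

lemma fraction_one: "\<one>\<^bsub>fraction_field R\<^esub> = ring_frac R \<one> \<one>"
  and fraction_zero: "\<zero>\<^bsub>fraction_field R\<^esub> = ring_frac R \<zero> \<one>"
  by (simp_all add: fraction_field_def)

lemmas fraction_simps = fraction_mult fraction_add fraction_one fraction_zero frac_in frac_eq_iff
  integral_iff

lemma frac_zero_iff:
  "\<lbrakk>a \<in> carrier R; b \<in> carrier R; b \<noteq> \<zero>\<rbrakk> \<Longrightarrow> ring_frac R a b = \<zero>\<^bsub>fraction_field R\<^esub> \<longleftrightarrow> a = \<zero>"
  by (simp add: fraction_simps)

lemma field_fraction_field: "field (fraction_field R)"
proof -
  let ?F = "fraction_field R"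
  have "cring ?F"
  proof (rule cringI)
    show "abelian_group ?F"
    proof (rule abelian_groupI)
      fix X Y Z assume "X \<in> carrier ?F" "Y \<in> carrier ?F" "Z \<in> carrier ?F"
      then show "X \<oplus>\<^bsub>?F\<^esub> Y \<oplus>\<^bsub>?F\<^esub> Z = X \<oplus>\<^bsub>?F\<^esub> (Y \<oplus>\<^bsub>?F\<^esub> Z)"
        by (elim frac_cases) (simp add: fraction_simps cring_simprules)
    next
      fix X assume "X \<in> carrier ?F"
      then obtain a b where X: "a \<in> carrier R" "b \<in> carrier R" "b \<noteq> \<zero>" "X = ring_frac R a b"
        by (rule frac_cases)
      then show "\<exists>Y\<in>carrier ?F. Y \<oplus>\<^bsub>?F\<^esub> X = \<zero>\<^bsub>?F\<^esub>"
        by (intro bexI[of _ "ring_frac R (\<ominus> a) b"]) (simp_all add: fraction_simps cring_simprules)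
    qed (auto elim!: frac_cases simp: fraction_simps cring_simprules)
    show "comm_monoid ?F"
    proof (rule comm_monoidI)
      fix X Y Z assume "X \<in> carrier ?F" "Y \<in> carrier ?F" "Z \<in> carrier ?F"
      then show "X \<otimes>\<^bsub>?F\<^esub> Y \<otimes>\<^bsub>?F\<^esub> Z = X \<otimes>\<^bsub>?F\<^esub> (Y \<otimes>\<^bsub>?F\<^esub> Z)"
        by (elim frac_cases) (simp add: fraction_simps cring_simprules)
    qed (auto elim!: frac_cases simp: fraction_simps cring_simprules)
    fix X Y Z assume "X \<in> carrier ?F" "Y \<in> carrier ?F" "Z \<in> carrier ?F"
    then show "(X \<oplus>\<^bsub>?F\<^esub> Y) \<otimes>\<^bsub>?F\<^esub> Z = X \<otimes>\<^bsub>?F\<^esub> Z \<oplus>\<^bsub>?F\<^esub> Y \<otimes>\<^bsub>?F\<^esub> Z"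
      by (elim frac_cases) (simp add: fraction_simps cring_simprules)
  qed
  then show ?thesis
  proof (rule cring.cring_fieldI2)
    show "\<zero>\<^bsub>?F\<^esub> \<noteq> \<one>\<^bsub>?F\<^esub>" by (simp add: fraction_simps)
    fix X assume X: "X \<in> carrier ?F" "X \<noteq> \<zero>\<^bsub>?F\<^esub>"
    then obtain a b where ab: "a \<in> carrier R" "b \<in> carrier R" "b \<noteq> \<zero>" "X = ring_frac R a b"
      by (blast elim: frac_cases)
    then have "a \<noteq> \<zero>" using X frac_zero_iff by blast
    with ab show "\<exists>Y\<in>carrier ?F. X \<otimes>\<^bsub>?F\<^esub> Y = \<one>\<^bsub>?F\<^esub>"
      by (intro bexI[of _ "ring_frac R b a"]) (simp_all add: fraction_simps m_comm)
  qed
qed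

lemma frac_hom: "(\<lambda>a. ring_frac R a \<one>) \<in> ring_hom R (fraction_field R)"
  by (rule ring_hom_memI) (simp_all add: fraction_simps)

end

section \<open>Automorphisms and derivations of domains, extended to fraction fields\<close>

locale difference_domain = "domain" R for R (structure) +
  fixes \<sigma> :: "'a \<Rightarrow> 'a"
  assumes s_iso: "\<sigma> \<in> ring_iso R R"
begin

lemmas s_closed = ring_iso_memE(1)[OF s_iso]
  and s_mult = ring_iso_memE(2)[OF s_iso]
  and s_add = ring_iso_memE(3)[OF s_iso]
  and s_one = ring_iso_memE(4)[OF s_iso]

lemma s_zero: "\<sigma> \<zero> = \<zero>"
  using s_add[of \<zero> \<zero>] s_closed[of \<zero>] by (metis add.l_cancel_one' r_zero zero_closed)

lemma s_minus: "x \<in> carrier R \<Longrightarrow> \<sigma> (\<ominus> x) = \<ominus> \<sigma> x"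
  by (metis a_inv_closed s_add s_closed s_zero l_neg minus_equality)

lemma s_inj: "\<lbrakk>x \<in> carrier R; y \<in> carrier R\<rbrakk> \<Longrightarrow> \<sigma> x = \<sigma> y \<longleftrightarrow> x = y"
  using ring_iso_memE(5)[OF s_iso] by (auto simp: bij_betw_def inj_on_def)

lemma s_surj: "y \<in> carrier R \<Longrightarrow> \<exists>x\<in>carrier R. \<sigma> x = y"
  using ring_iso_memE(5)[OF s_iso] by (metis bij_betw_imp_surj_on imageE)

lemma s_zero_iff: "x \<in> carrier R \<Longrightarrow> \<sigma> x = \<zero> \<longleftrightarrow> x = \<zero>"
  using s_inj[of x \<zero>] s_zero by simp

end

locale difference_differential_domain = difference_domain R \<sigma> + differential_ring R \<delta>
  for R (structure) and \<sigma> and \<delta> +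
  assumes d_commute: "x \<in> carrier R \<Longrightarrow> \<delta> (\<sigma> x) = \<sigma> (\<delta> x)"
begin

definition frac_d :: "('a \<times> 'a) set \<Rightarrow> ('a \<times> 'a) set" where
  "frac_d X = ring_frac R (\<delta> (num X) \<otimes> den X \<ominus> num X \<otimes> \<delta> (den X)) (den X \<otimes> den X)"

definition frac_s :: "('a \<times> 'a) set \<Rightarrow> ('a \<times> 'a) set" where
  "frac_s X = ring_frac R (\<sigma> (num X)) (\<sigma> (den X))"

lemma frac_s:
  assumes a: "a \<in> carrier R" "b \<in> carrier R" "b \<noteq> \<zero>"
  shows "frac_s (ring_frac R a b) = ring_frac R (\<sigma> a) (\<sigma> b)"
proof -
  note A = num_den[OF a]
  have "\<sigma> (a \<otimes> den (ring_frac R a b)) = \<sigma> (num (ring_frac R a b) \<otimes> b)"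
    using A by simp
  then show ?thesis
    using a A(1-3) by (simp add: frac_s_def frac_eq_iff s_mult s_closed s_zero_iff)
qed

lemma frac_d:
  assumes a: "a \<in> carrier R" "b \<in> carrier R" "b \<noteq> \<zero>"
  shows "frac_d (ring_frac R a b) = ring_frac R (\<delta> a \<otimes> b \<ominus> a \<otimes> \<delta> b) (b \<otimes> b)"
proof -
  let ?n = "num (ring_frac R a b)" and ?m = "den (ring_frac R a b)"
  note A = num_den[OF a]
  note closed = a A(1-3) d_closed[OF a(1)] d_closed[OF a(2)] d_closed[OF A(1)] d_closed[OF A(2)]
  have "\<delta> (a \<otimes> ?m) = \<delta> (?n \<otimes> b)" using A by simp
  then have D: "\<delta> a \<otimes> ?m \<oplus> a \<otimes> \<delta> ?m = \<delta> ?n \<otimes> b \<oplus> ?n \<otimes> \<delta> b"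
    using a A(1-3) by (simp add: d_mult)
  \<comment> \<open>The left side is arranged so that \<open>?n\<close> occurs only in
    \<open>?n \<otimes> b\<close> and in the derivative of that product. Both can then be exchanged
    for \<open>a \<otimes> ?m\<close> and its derivative.\<close>
  have "(\<delta> ?n \<otimes> ?m \<ominus> ?n \<otimes> \<delta> ?m) \<otimes> (b \<otimes> b) =
    (\<delta> ?n \<otimes> b \<oplus> ?n \<otimes> \<delta> b) \<otimes> (?m \<otimes> b) \<ominus> (?n \<otimes> b) \<otimes> (?m \<otimes> \<delta> b) \<ominus> (?n \<otimes> b) \<otimes> (\<delta> ?m \<otimes> b)"
    using closed by algebra
  also have "\<dots> = (\<delta> a \<otimes> ?m \<oplus> a \<otimes> \<delta> ?m) \<otimes> (?m \<otimes> b) \<ominus> (a \<otimes> ?m) \<otimes> (?m \<otimes> \<delta> b) \<ominus> (a \<otimes> ?m) \<otimes> (\<delta> ?m \<otimes> b)"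
    by (simp only: D A(4))
  also have "\<dots> = (\<delta> a \<otimes> b \<ominus> a \<otimes> \<delta> b) \<otimes> (?m \<otimes> ?m)"
    using closed by algebra
  finally show ?thesis
    using closed by (simp add: frac_d_def frac_eq_iff integral_iff)
qed

lemma frac_s_iso: "frac_s \<in> ring_iso (fraction_field R) (fraction_field R)"
proof (rule ring_iso_memI)
  let ?F = "fraction_field R"
  show "bij_betw frac_s (carrier ?F) (carrier ?F)"
    unfolding bij_betw_def
  proof
    show "inj_on frac_s (carrier ?F)"
    proof (rule inj_onI)
      fix X Y assume "X \<in> carrier ?F" "Y \<in> carrier ?F" "frac_s X = frac_s Y"
      then show "X = Y"
        by (elim frac_cases)
          (simp add: frac_s frac_eq_iff s_closed s_zero_iff s_mult[symmetric] s_inj)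
    qed
    show "frac_s ` carrier ?F = carrier ?F"
    proof (intro equalityI subsetI)
      fix X assume "X \<in> carrier ?F"
      then obtain a b where ab: "a \<in> carrier R" "b \<in> carrier R" "b \<noteq> \<zero>" "X = ring_frac R a b"
        by (rule frac_cases)
      then obtain a' b' where "a' \<in> carrier R" "\<sigma> a' = a" "b' \<in> carrier R" "\<sigma> b' = b"
        using s_surj by meson
      with ab show "X \<in> frac_s ` carrier ?F"
        by (intro image_eqI[of _ _ "ring_frac R a' b'"]) (auto simp: frac_s s_zero_iff intro!: frac_in)
    qed (auto elim!: frac_cases simp: frac_s frac_in s_closed s_zero_iff)
  qed
qed (auto elim!: frac_cases simp: frac_s fraction_simps s_closed s_zero_iff s_mult s_add s_one)

lemma frac_d_axioms: "differential_ring (fraction_field R) frac_d"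
proof (intro differential_ring.intro differential_ring_axioms.intro)
  let ?F = "fraction_field R"
  show "cring ?F" using field_fraction_field by (simp add: fieldE)
  fix X assume X: "X \<in> carrier ?F"
  then show "frac_d X \<in> carrier ?F"
    by (elim frac_cases) (simp add: frac_d frac_in d_closed integral_iff)
  fix Y assume Y: "Y \<in> carrier ?F"
  obtain a b where ab: "a \<in> carrier R" "b \<in> carrier R" "b \<noteq> \<zero>" "X = ring_frac R a b"
    using X by (rule frac_cases)
  obtain c d where cd: "c \<in> carrier R" "d \<in> carrier R" "d \<noteq> \<zero>" "Y = ring_frac R c d"
    using Y by (rule frac_cases)
  note cl = ab cd d_closed[OF ab(1)] d_closed[OF ab(2)] d_closed[OF cd(1)] d_closed[OF cd(2)]
  let ?P = "\<delta> a \<otimes> b \<ominus> a \<otimes> \<delta> b" and ?Q = "\<delta> c \<otimes> d \<ominus> c \<otimes> \<delta> d"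
  have PQ: "?P \<in> carrier R" "?Q \<in> carrier R"
    using cl by auto
  have "((\<delta> a \<otimes> d \<oplus> a \<otimes> \<delta> d) \<oplus> (\<delta> c \<otimes> b \<oplus> c \<otimes> \<delta> b)) \<otimes> (b \<otimes> d)
      \<ominus> (a \<otimes> d \<oplus> c \<otimes> b) \<otimes> (\<delta> b \<otimes> d \<oplus> b \<otimes> \<delta> d) = ?P \<otimes> (d \<otimes> d) \<oplus> ?Q \<otimes> (b \<otimes> b)"
    using cl(1,2,5,6,9-) by algebra
  moreover have "(b \<otimes> b) \<otimes> (d \<otimes> d) = (b \<otimes> d) \<otimes> (b \<otimes> d)"
    using cl by (simp add: m_ac)
  ultimately show "frac_d (X \<oplus>\<^bsub>?F\<^esub> Y) = frac_d X \<oplus>\<^bsub>?F\<^esub> frac_d Y"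
    using cl PQ by (simp add: frac_d fraction_simps d_add d_mult)
  have e2: "(\<delta> a \<otimes> c \<oplus> a \<otimes> \<delta> c) \<otimes> (b \<otimes> d) \<ominus> (a \<otimes> c) \<otimes> (\<delta> b \<otimes> d \<oplus> b \<otimes> \<delta> d) =
      ?P \<otimes> (c \<otimes> d) \<oplus> ?Q \<otimes> (a \<otimes> b)"
    using cl(1,2,5,6,9-) by algebra
  \<comment> \<open>Cross multiplication for the Leibniz rule. The two quotient-rule numerators are
    generalised to \<open>p\<close> and \<open>q\<close>, so that the simplifier treats them as
    atoms and does not expand them.\<close>
  have "(p \<otimes> (c \<otimes> d) \<oplus> q \<otimes> (a \<otimes> b)) \<otimes> (((b \<otimes> b) \<otimes> d) \<otimes> (b \<otimes> (d \<otimes> d))) =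
      ((p \<otimes> c) \<otimes> (b \<otimes> (d \<otimes> d)) \<oplus> (a \<otimes> q) \<otimes> ((b \<otimes> b) \<otimes> d)) \<otimes> ((b \<otimes> d) \<otimes> (b \<otimes> d))"
    if "p \<in> carrier R" "q \<in> carrier R" for p q
    using cl(1,2,5,6) that by (simp add: l_distr r_distr m_ac)
  note e3 = this[OF PQ]
  show "frac_d (X \<otimes>\<^bsub>?F\<^esub> Y) = frac_d X \<otimes>\<^bsub>?F\<^esub> Y \<oplus>\<^bsub>?F\<^esub> X \<otimes>\<^bsub>?F\<^esub> frac_d Y"
    using cl PQ e2 e3 by (simp add: frac_d fraction_simps d_add d_mult)
qed

lemma frac_commute: "X \<in> carrier (fraction_field R) \<Longrightarrow> frac_d (frac_s X) = frac_s (frac_d X)"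
  by (elim frac_cases)
    (simp add: frac_d frac_s fraction_simps s_closed s_zero_iff s_mult s_add s_minus d_closed
      d_commute minus_eq)

lemma frac_d_of: "a \<in> carrier R \<Longrightarrow> frac_d (ring_frac R a \<one>) = ring_frac R (\<delta> a) \<one>"
  by (simp add: frac_d frac_eq_iff d_one d_closed minus_eq)

lemma frac_s_of: "a \<in> carrier R \<Longrightarrow> frac_s (ring_frac R a \<one>) = ring_frac R (\<sigma> a) \<one>"
  by (simp add: frac_s s_one)

end

sublocale difference_field \<subseteq> difference_domain K \<sigma>
  by unfold_locales (rule automorphism)

sublocale difference_differential_field \<subseteq> difference_differential_domain K \<sigma> D
  by unfold_locales (simp_all add: D_closed D_add D_mult D_commute)

section \<open>Field homomorphisms and characteristic zero\<close>

lemma ring_hom_add_pow: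
  assumes "ring R" "ring S" "f \<in> ring_hom R S" "x \<in> carrier R"
  shows "f (add_pow R (n::nat) x) = add_pow S n (f x)"
proof -
  interpret ring_hom_ring R S f using assms by (intro ring_hom_ringI2)
  show ?thesis
  proof (induction n)
    case 0
    then show ?case by simp
  next
    case (Suc n)
    then show ?case using assms(4) by simp
  qed
qed

lemma field_hom_nonzero:
  assumes "field R" "ring S" "f \<in> ring_hom R S" "\<one>\<^bsub>S\<^esub> \<noteq> \<zero>\<^bsub>S\<^esub>" "x \<in> carrier R" "x \<noteq> \<zero>\<^bsub>R\<^esub>"
  shows "f x \<noteq> \<zero>\<^bsub>S\<^esub>"
proof
  assume fx: "f x = \<zero>\<^bsub>S\<^esub>"
  interpret R: field R by fact
  interpret S: ring S by fact
  have x: "inv\<^bsub>R\<^esub> x \<in> carrier R" "x \<otimes>\<^bsub>R\<^esub> inv\<^bsub>R\<^esub> x = \<one>\<^bsub>R\<^esub>"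
    using R.field_Units assms by auto
  then have "f x \<otimes>\<^bsub>S\<^esub> f (inv\<^bsub>R\<^esub> x) = \<one>\<^bsub>S\<^esub>"
    using assms(3,5) by (metis ring_hom_mult ring_hom_one)
  then show False using fx x assms(3,4) ring_hom_closed by fastforce
qed

lemma field_char_zero_hom:
  assumes "field_char_zero R" "field S" "f \<in> ring_hom R S"
  shows "field_char_zero S"
proof -
  interpret R: field_char_zero R by fact
  interpret S: field S by fact
  show ?thesis
  proof unfold_locales
    fix n :: nat assume "n > 0"
    then have "f (add_pow R n \<one>\<^bsub>R\<^esub>) \<noteq> \<zero>\<^bsub>S\<^esub>"
      using R.char_zero by (intro field_hom_nonzero[OF R.field_axioms S.ring_axioms assms(3)]) auto
    then show "add_pow S n \<one>\<^bsub>S\<^esub> \<noteq> \<zero>\<^bsub>S\<^esub>"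
      using ring_hom_add_pow[OF R.ring_axioms S.ring_axioms assms(3), of "\<one>\<^bsub>R\<^esub>" n]
        ring_hom_one[OF assms(3)] by simp
  qed
qed

section \<open>Existential closedness\<close>

lemma ec_inD:
  fixes a :: "nat \<Rightarrow> 'a" and b :: "nat \<Rightarrow> 'b"
  assumes "ec_in R I S J h" "range a \<subseteq> carrier R" "range b \<subseteq> carrier S"
    and "qf_sat S J (case_sum (h \<circ> a) b) \<phi>"
  shows "\<exists>c :: nat \<Rightarrow> 'a. range c \<subseteq> carrier R \<and> qf_sat R I (case_sum a c) \<phi>"
  using assms unfolding ec_in_def by blast

section \<open>Transfer of quantifier-free formulas\<close>

lemma tm_val_embedding:
  assumes "ring R" "ring S" "op_embedding R I S J f" "\<And>u x. x \<in> carrier R \<Longrightarrow> I u x \<in> carrier R"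
    and "range e \<subseteq> carrier R"
  shows "tm_val R I e t \<in> carrier R \<and> tm_val S J (f \<circ> e) t = f (tm_val R I e t)"
proof -
  interpret ring_hom_ring R S f
    using assms by (intro ring_hom_ringI2) (simp_all add: op_embedding_def)
  show ?thesis
    using assms(3-5) by (induction t) (auto simp: op_embedding_def R.minus_eq S.minus_eq)
qed

lemma qf_sat_embedding:
  assumes "ring R" "ring S" "op_embedding R I S J f" "\<And>u x. x \<in> carrier R \<Longrightarrow> I u x \<in> carrier R"
    and "range e \<subseteq> carrier R" "inj_on f (carrier R)"
  shows "qf_sat S J (f \<circ> e) \<phi> \<longleftrightarrow> qf_sat R I e \<phi>"
  using tm_val_embedding[OF assms(1-5)] assms(6)
  by (induction \<phi>) (auto dest: inj_onD)

lemma tm_val_cong: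
  "(\<And>v. v \<in> set2_tm t \<Longrightarrow> e v = e' v) \<Longrightarrow> tm_val R I e t = tm_val R I e' t"
  by (induction t) auto

text \<open>Variables absent from the formula may be reassigned freely. Together with the finiteness
  of the set of occurring variables this allows a single formula to force all relevant values to be
  constants.\<close>

lemma qf_sat_cong:
  "(\<And>v. v \<in> set2_qf \<phi> \<Longrightarrow> e v = e' v) \<Longrightarrow> qf_sat R I e \<phi> = qf_sat R I e' \<phi>"
proof (induction \<phi>)
  case (Equal s t)
  then show ?case using tm_val_cong[of s e e' R I] tm_val_cong[of t e e' R I] by simp
qed auto

lemma finite_set2_tm: "finite (set2_tm t)"
  by (induction t) auto

lemma finite_set2_qf: "finite (set2_qf \<phi>)"
  by (induction \<phi>) (auto simp: finite_set2_tm)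

lemma tm_val_map: "tm_val R I e (map_tm s id t) = tm_val R (\<lambda>u. I (s u)) e t"
  by (induction t) auto

text \<open>Serves to read a formula about difference fields in the language with a derivation:
  renaming the symbols amounts to reindexing their interpretation.\<close>

lemma qf_sat_map: "qf_sat R I e (map_qf s id \<phi>) = qf_sat R (\<lambda>u. I (s u)) e \<phi>"
  by (induction \<phi>) (auto simp: tm_val_map[unfolded id_def] id_def)

section \<open>Substructures, transported structures and closures of bounded size\<close>

lemma add_pow_sub: "add_pow (R\<lparr>carrier := Y\<rparr>) (n::nat) x = add_pow R n x"
  by (simp add: add_pow_def nat_pow_def)

text \<open>The image of \<open>Y\<close> has to be all of \<open>Y\<close>, since the restriction
  must stay surjective. This is why the closure taken for Loewenheim-Skolem includes the inverse
  automorphism.\<close>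

lemma (in difference_field) difference_field_sub:
  assumes Y: "subfield Y K" and s: "\<sigma> ` Y = Y"
  shows "difference_field (K\<lparr>carrier := Y\<rparr>) \<sigma>"
proof -
  have f: "field (K\<lparr>carrier := Y\<rparr>)" using subfield_iff(2)[OF Y] .
  have sub: "Y \<subseteq> carrier K" using subfieldE(3)[OF Y] .
  have "\<sigma> \<in> ring_iso (K\<lparr>carrier := Y\<rparr>) (K\<lparr>carrier := Y\<rparr>)"
  proof (rule ring_iso_memI)
    have "inj_on \<sigma> Y" using s_inj sub by (auto intro!: inj_onI)
    then show "bij_betw \<sigma> (carrier (K\<lparr>carrier := Y\<rparr>)) (carrier (K\<lparr>carrier := Y\<rparr>))"
      using s by (simp add: bij_betw_def)
  qed (use sub s in \<open>auto simp: s_add s_mult s_one subset_iff\<close>)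
  then show ?thesis
    using f char_zero
    by (simp add: difference_field_def difference_field_axioms_def field_char_zero_def
        field_char_zero_axioms_def add_pow_sub)
qed

lemma (in difference_differential_field) difference_differential_field_sub:
  assumes Y: "subfield Y K" and s: "\<sigma> ` Y = Y" and d: "\<And>y. y \<in> Y \<Longrightarrow> D y \<in> Y"
  shows "difference_differential_field (K\<lparr>carrier := Y\<rparr>) \<sigma> D"
proof -
  have sub: "Y \<subseteq> carrier K" using subfieldE(3)[OF Y] .
  show ?thesis
    using difference_field_sub[OF Y s] d sub
    by (auto simp: difference_differential_field_def difference_differential_field_axioms_def subset_iff
        d_add d_mult d_commute)
qed

text \<open>Transport of structure by conjugation with \<open>g\<close>. The target type may differ
  from the source type, which is how a subfield of an arbitrary extension is brought to the type of
  the base field.\<close>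

lemma (in difference_differential_field) difference_differential_field_image:
  assumes g: "inj_on g (carrier K)"
  defines "g' \<equiv> inv_into (carrier K) g"
  shows "difference_differential_field (image_ring g K) (g \<circ> \<sigma> \<circ> g') (g \<circ> D \<circ> g')"
proof -
  let ?M = "image_ring g K"
  have iso: "g \<in> ring_iso K ?M" using inj_imp_image_ring_iso[OF g] .
  have g': "g' (g x) = x" if "x \<in> carrier K" for x
    using g that by (simp add: g'_def)
  have car: "carrier ?M = g ` carrier K" by (rule image_ring_carrier)
  note hom = ring_iso_memE(2,3)[OF iso, symmetric]
  have F: "field_char_zero ?M"
    using field_char_zero_hom[OF field_char_zero_axioms inj_imp_image_ring_is_field[OF g]] iso
    by (auto simp: ring_iso_def)
  have "g \<circ> \<sigma> \<circ> g' \<in> ring_iso ?M ?M"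
  proof (rule ring_iso_memI)
    show "bij_betw (g \<circ> \<sigma> \<circ> g') (carrier ?M) (carrier ?M)"
      unfolding bij_betw_def
    proof
      show "inj_on (g \<circ> \<sigma> \<circ> g') (carrier ?M)"
        by (rule inj_onI) (auto simp: car g' s_closed inj_on_eq_iff[OF g] s_inj)
      show "(g \<circ> \<sigma> \<circ> g') ` carrier ?M = carrier ?M"
      proof (intro equalityI subsetI)
        fix y assume "y \<in> carrier ?M"
        then obtain x where x: "x \<in> carrier K" "y = g x" by (auto simp: car)
        then obtain z where "z \<in> carrier K" "\<sigma> z = x" using s_surj by blast
        then show "y \<in> (g \<circ> \<sigma> \<circ> g') ` carrier ?M"
          using x by (intro image_eqI[of _ _ "g z"]) (auto simp: car g')
      qed (auto simp: car g' s_closed)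
    qed
    show "(g \<circ> \<sigma> \<circ> g') \<one>\<^bsub>?M\<^esub> = \<one>\<^bsub>?M\<^esub>" by (simp add: image_ring_one g' s_one)
  qed (auto simp: car g' s_closed hom s_mult s_add)
  with F show ?thesis
    by (auto simp: difference_differential_field_def difference_differential_field_axioms_def
        difference_field_def difference_field_axioms_def car g' s_closed d_closed hom d_add d_mult
        d_commute)
qed

text \<open>The closure is a union of countably many stages, each adding the values of
  \<open>F\<close> on pairs from the one before. Infinite \<open>A\<close> absorbs squares, finite
  unions and countable unions. Only binary functions occur; a unary one is represented by a binary
  one that ignores its second argument.\<close>

lemma closure_card:
  includes cardinal_syntax
  fixes F :: "('c \<Rightarrow> 'c \<Rightarrow> 'c) set"
  assumes inf: "infinite A" and X: "|X| \<le>o |A|" and fin: "finite F"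
    and sub: "X \<subseteq> Z" and Z: "\<And>f x y. \<lbrakk>f \<in> F; x \<in> Z; y \<in> Z\<rbrakk> \<Longrightarrow> f x y \<in> Z"
  shows "\<exists>Y. X \<subseteq> Y \<and> Y \<subseteq> Z \<and> |Y| \<le>o |A| \<and> (\<forall>f\<in>F. \<forall>x\<in>Y. \<forall>y\<in>Y. f x y \<in> Y)"
proof -
  define S where "S = rec_nat X (\<lambda>_ T. T \<union> (\<Union>f\<in>F. (\<lambda>(x, y). f x y) ` (T \<times> T)))"
  have S0: "S 0 = X" and SS: "S (Suc n) = S n \<union> (\<Union>f\<in>F. (\<lambda>(x, y). f x y) ` (S n \<times> S n))" for n
    by (simp_all add: S_def)
  have card: "|S n| \<le>o |A|" for n
  proof (induction n)
    case 0
    then show ?case using X S0 by simp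
  next
    case (Suc n)
    have "|S n \<times> S n| \<le>o |A|"
      using card_of_Times_ordLeq_infinite_Field[of "|A|" "S n" "S n"] inf Suc.IH
      by (simp add: Field_card_of card_of_card_order_on)
    then have "|(\<lambda>(x, y). f x y) ` (S n \<times> S n)| \<le>o |A|" for f :: "'c \<Rightarrow> 'c \<Rightarrow> 'c"
      using card_of_image ordLeq_transitive by blast
    moreover have "|F| \<le>o |A|"
      using finite_ordLess_infinite[of "|F|" "|A|"] fin inf ordLess_imp_ordLeq
      by (simp add: Field_card_of card_of_well_order_on)
    ultimately have "|\<Union>f\<in>F. (\<lambda>(x, y). f x y) ` (S n \<times> S n)| \<le>o |A|"
      using inf by (intro card_of_UNION_ordLeq_infinite) auto
    then show ?case
      unfolding SS using Suc.IH inf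
      by (intro card_of_Un_ordLeq_infinite_Field[of "|A|"]) (simp_all add: Field_card_of card_of_card_order_on)
  qed
  have mono: "S n \<subseteq> S (n + m)" for n m
    by (induction m) (auto simp: SS)
  have closed: "f x y \<in> (\<Union>n. S n)" if "f \<in> F" "x \<in> (\<Union>n. S n)" "y \<in> (\<Union>n. S n)" for f x y
  proof -
    from that obtain n m where "x \<in> S n" "y \<in> S m" by blast
    then have "x \<in> S (n + m)" "y \<in> S (n + m)"
      using mono[of n m] mono[of m n] by (auto simp: add.commute)
    then have "f x y \<in> S (Suc (n + m))" using that(1) unfolding SS by blast
    then show ?thesis by blast
  qed
  have bound: "|\<Union>n. S n| \<le>o |A|"
    using inf card infinite_iff_card_of_nat by (intro card_of_UNION_ordLeq_infinite) auto
  have subset: "S n \<subseteq> Z" for n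
  proof (induction n)
    case 0
    then show ?case using sub S0 by simp
  next
    case (Suc n)
    have "(\<lambda>(x, y). f x y) ` (S n \<times> S n) \<subseteq> Z" if f: "f \<in> F" for f
    proof clarify
      fix x y assume "x \<in> S n" "y \<in> S n"
      then have "x \<in> Z" "y \<in> Z" using Suc by auto
      then show "f x y \<in> Z" by (rule Z[OF f])
    qed
    with Suc show ?case unfolding SS by (intro Un_least UN_least)
  qed
  show ?thesis
  proof (intro exI conjI ballI)
    show "X \<subseteq> (\<Union>n. S n)" using S0 by blast
  qed (use subset bound closed in auto)
qed

lemma (in field_char_zero) infinite_carrier: "infinite (carrier K)"
proof -
  have "inj (\<lambda>n::nat. [n] \<cdot> \<one>)"
  proof (rule linorder_injI)
    fix m n :: nat assume "m < n"
    then obtain k where k: "n = m + Suc k" using less_iff_Suc_add by auto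
    have "[n] \<cdot> \<one> = [m] \<cdot> \<one> \<oplus> [Suc k] \<cdot> \<one>"
      unfolding k by (rule add.nat_pow_mult[symmetric]) simp
    moreover have "[Suc k] \<cdot> \<one> \<noteq> \<zero>" using char_zero[of "Suc k"] by blast
    ultimately show "[m] \<cdot> \<one> \<noteq> [n] \<cdot> \<one>"
      by (metis add.l_cancel_one' add.nat_pow_closed one_closed)
  qed
  moreover have "range (\<lambda>n::nat. [n] \<cdot> \<one>) \<subseteq> carrier K" by auto
  ultimately show ?thesis using infinite_iff_countable_subset by blast
qed

text \<open>Downward Loewenheim--Skolem: a witness in an extension lies in a subfield of the cardinality
  of \<open>K\<close>, which has a copy on the type of \<open>K\<close>.\<close>

lemma DCFA_model_ec_in:
  includes cardinal_syntax
  fixes K :: "'a ring" and L :: "'c ring"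
  assumes model: "DCFA_model TYPE('a) K \<sigma> D"
    and L: "difference_differential_field L \<tau> E"
    and h: "op_embedding K (case_difference_differential_symbol \<sigma> D)
              L (case_difference_differential_symbol \<tau> E) h"
  shows "ec_in K (case_difference_differential_symbol \<sigma> D)
           L (case_difference_differential_symbol \<tau> E) h"
  unfolding ec_in_def
proof (intro allI impI)
  fix \<phi> :: "(difference_differential_symbol, nat + nat) qf" and a :: "nat \<Rightarrow> 'a"
  let ?I = "case_difference_differential_symbol \<sigma> D"
  let ?J = "case_difference_differential_symbol \<tau> E"
  assume a: "range a \<subseteq> carrier K"
    and "\<exists>b. range b \<subseteq> carrier L \<and> qf_sat L ?J (case_sum (h \<circ> a) b) \<phi>"
  then obtain b where b: "range b \<subseteq> carrier L" "qf_sat L ?J (case_sum (h \<circ> a) b) \<phi>" by blast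
  interpret K: difference_differential_field K \<sigma> D using model by (simp add: DCFA_model_def)
  interpret L: difference_differential_field L \<tau> E by (rule L)
  have hom: "h \<in> ring_hom K L" using h by (simp add: op_embedding_def)
  define X where "X = h ` carrier K \<union> range b"
  \<comment> \<open>The inverse is totalised at zero to keep its values in \<open>carrier L\<close>.
    The inverse of \<open>\<tau>\<close> makes \<open>\<tau>\<close> restrict to a bijection of the
    closure.\<close>
  define F where "F = {add L, mult L, \<lambda>x _. a_inv L x, \<lambda>x _. if x = \<zero>\<^bsub>L\<^esub> then x else inv\<^bsub>L\<^esub> x,
    \<lambda>x _. \<tau> x, \<lambda>x _. inv_into (carrier L) \<tau> x, \<lambda>x _. E x}"
  have inf: "infinite (carrier K)" by (rule K.infinite_carrier)
  have "|range b| \<le>o |carrier K|"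
    using inf infinite_iff_card_of_nat card_of_image ordLeq_transitive by blast
  then have X: "|X| \<le>o |carrier K|"
    unfolding X_def using inf card_of_image
    by (intro card_of_Un_ordLeq_infinite_Field[of "|carrier K|"])
      (simp_all add: Field_card_of card_of_card_order_on)
  have bij: "bij_betw \<tau> (carrier L) (carrier L)" using ring_iso_memE(5)[OF L.automorphism] .
  have inv_closed: "inv\<^bsub>L\<^esub> x \<in> carrier L" if "x \<in> carrier L" "x \<noteq> \<zero>\<^bsub>L\<^esub>" for x
    using that L.field_Units by auto
  have "\<exists>Y. X \<subseteq> Y \<and> Y \<subseteq> carrier L \<and> |Y| \<le>o |carrier K| \<and> (\<forall>f\<in>F. \<forall>x\<in>Y. \<forall>y\<in>Y. f x y \<in> Y)"
  proof (rule closure_card[OF inf X])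
    show "finite F" by (simp add: F_def)
    show "X \<subseteq> carrier L" using b ring_hom_closed[OF hom] by (auto simp: X_def)
    show "f x y \<in> carrier L" if "f \<in> F" "x \<in> carrier L" "y \<in> carrier L" for f x y
      using that bij_betwE[OF bij] bij_betwE[OF bij_betw_inv_into[OF bij]] inv_closed L.d_closed
      by (auto simp: F_def)
  qed
  then obtain Y where Y: "X \<subseteq> Y" "Y \<subseteq> carrier L" "|Y| \<le>o |carrier K|"
    and "\<forall>f\<in>F. \<forall>x\<in>Y. \<forall>y\<in>Y. f x y \<in> Y" by blast
  then have cl: "\<And>x y. \<lbrakk>x \<in> Y; y \<in> Y\<rbrakk> \<Longrightarrow> x \<oplus>\<^bsub>L\<^esub> y \<in> Y" "\<And>x y. \<lbrakk>x \<in> Y; y \<in> Y\<rbrakk> \<Longrightarrow> x \<otimes>\<^bsub>L\<^esub> y \<in> Y"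
    "\<And>x. x \<in> Y \<Longrightarrow> \<ominus>\<^bsub>L\<^esub> x \<in> Y" "\<And>x. \<lbrakk>x \<in> Y; x \<noteq> \<zero>\<^bsub>L\<^esub>\<rbrakk> \<Longrightarrow> inv\<^bsub>L\<^esub> x \<in> Y"
    "\<And>x. x \<in> Y \<Longrightarrow> \<tau> x \<in> Y" "\<And>x. x \<in> Y \<Longrightarrow> inv_into (carrier L) \<tau> x \<in> Y" "\<And>x. x \<in> Y \<Longrightarrow> E x \<in> Y"
    by (auto simp: F_def split: if_splits)
  have "h \<one>\<^bsub>K\<^esub> \<in> X" by (simp add: X_def)
  then have one: "\<one>\<^bsub>L\<^esub> \<in> Y" using Y(1) ring_hom_one[OF hom] by auto
  have "subring Y L"
    by (rule L.subringI[OF Y(2) one cl(3,2,1)])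
  then have sf: "subfield Y L"
    by (rule L.subfieldI') (simp add: cl(4))
  have "\<tau> ` Y = Y"
  proof (intro equalityI subsetI)
    fix y assume "y \<in> Y"
    then have "\<tau> (inv_into (carrier L) \<tau> y) = y" "inv_into (carrier L) \<tau> y \<in> Y"
      using bij_betw_inv_into_right[OF bij] Y(2) cl by auto
    then show "y \<in> \<tau> ` Y" by (metis imageI)
  qed (use cl in auto)
  then interpret M: difference_differential_field "L\<lparr>carrier := Y\<rparr>" \<tau> E
    using L.difference_differential_field_sub[OF sf] cl by blast
  let ?M = "L\<lparr>carrier := Y\<rparr>"
  \<comment> \<open>This is an injection of sets only. The copy \<open>N\<close> receives its
    operations from \<open>?M\<close> through \<open>g\<close>; although its carrier consists of
    elements of K, its structure is unrelated to that of K.\<close>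
  obtain g where g: "inj_on g Y" "g ` Y \<subseteq> carrier K"
    using Y(3) card_of_ordLeq[of Y "carrier K"] by blast
  define g' where "g' = inv_into Y g"
  define N where "N = image_ring g ?M"
  let ?I' = "case_difference_differential_symbol (g \<circ> \<tau> \<circ> g') (g \<circ> E \<circ> g')"
  interpret N: difference_differential_field N "g \<circ> \<tau> \<circ> g'" "g \<circ> E \<circ> g'"
    using M.difference_differential_field_image[of g] g by (simp add: N_def g'_def)
  have g': "g' (g y) = y" if "y \<in> Y" for y using g that by (simp add: g'_def)
  have "g \<in> ring_hom ?M N"
    using inj_imp_image_ring_iso[of g ?M] g by (simp add: N_def ring_iso_def)
  then have M_N: "op_embedding ?M ?J N ?I' g"
    by (simp add: op_embedding_def g' split: difference_differential_symbol.split)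
  have M_L: "op_embedding ?M ?J L ?J id"
    using Y(2) by (auto simp: op_embedding_def ring_hom_def)
  have hM: "h \<in> ring_hom K ?M"
    using hom Y(1) by (auto simp: ring_hom_def X_def)
  then have "g \<circ> h \<in> ring_hom K N" using \<open>g \<in> ring_hom ?M N\<close> ring_hom_trans by blast
  then have K_N: "op_embedding K ?I N ?I' (g \<circ> h)"
    using h M_N ring_hom_closed[OF hM] by (simp add: op_embedding_def)
  have ab: "range (case_sum (h \<circ> a) b) \<subseteq> Y"
    using a Y(1) by (auto simp: X_def image_subset_iff split: sum.splits)
  have M_closed: "?J u x \<in> carrier ?M" if "x \<in> carrier ?M" for u x
    using that cl by (cases u) auto
  \<comment> \<open>Satisfaction is first restricted from L to the subfield containing parameters
    and witnesses, then carried along the isomorphism \<open>g\<close> to \<open>N\<close>, where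
    the hypothesis on K applies.\<close>
  have "qf_sat ?M ?J (case_sum (h \<circ> a) b) \<phi>"
    using qf_sat_embedding[OF M.ring_axioms L.ring_axioms M_L M_closed, of "case_sum (h \<circ> a) b" \<phi>]
      ab b(2) by simp
  then have "qf_sat N ?I' (g \<circ> case_sum (h \<circ> a) b) \<phi>"
    using qf_sat_embedding[OF M.ring_axioms N.ring_axioms M_N M_closed, of "case_sum (h \<circ> a) b" \<phi>]
      ab g by simp
  moreover have "g \<circ> case_sum (h \<circ> a) b = case_sum ((g \<circ> h) \<circ> a) (g \<circ> b)"
    by (auto simp: fun_eq_iff split: sum.splits)
  moreover have "range (g \<circ> b) \<subseteq> carrier N"
    using Y(1) by (auto simp: N_def image_ring_carrier X_def)
  moreover have "ec_in K ?I N ?I' (g \<circ> h)"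
    using model N.difference_differential_field_axioms K_N unfolding DCFA_model_def by blast
  ultimately show "\<exists>c. range c \<subseteq> carrier K \<and> qf_sat K ?I (case_sum a c) \<phi>"
    using a unfolding ec_in_def by metis
qed

section \<open>The compositum of a difference-differential field and an extension of its constants\<close>

context difference_differential_field
begin

section \<open>The difference field of constants\<close>

definition constants :: "'a set" where
  "constants = {x \<in> carrier K. D x = \<zero>}"

lemma constants_closed:
  "c \<in> constants \<Longrightarrow> c \<in> carrier K" "\<zero> \<in> constants" "\<one> \<in> constants"
  "\<lbrakk>c \<in> constants; d \<in> constants\<rbrakk> \<Longrightarrow> c \<oplus> d \<in> constants"
  "\<lbrakk>c \<in> constants; d \<in> constants\<rbrakk> \<Longrightarrow> c \<otimes> d \<in> constants"
  "c \<in> constants \<Longrightarrow> \<ominus> c \<in> constants"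
  "c \<in> constants \<Longrightarrow> \<sigma> c \<in> constants"
  by (auto simp: constants_def d_zero d_one d_add d_mult d_minus d_commute s_closed s_zero)

lemma constants_inv: "\<lbrakk>c \<in> constants; c \<noteq> \<zero>\<rbrakk> \<Longrightarrow> inv c \<in> constants"
proof -
  assume c: "c \<in> constants" "c \<noteq> \<zero>"
  then have i: "inv c \<in> carrier K" "c \<in> carrier K" "c \<otimes> inv c = \<one>"
    using field_Units by (auto simp: constants_def)
  have "D (c \<otimes> inv c) = c \<otimes> D (inv c)"
    using c i d_mult[of c "inv c"] d_closed by (simp add: constants_def)
  then have "c \<otimes> D (inv c) = \<zero>" using i d_one by simp
  then show ?thesis using c i d_closed integral_iff by (auto simp: constants_def)
qed

lemma subfield_constants: "subfield constants K"
proof (rule subfieldI')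
  show "subring constants K"
    by (rule subringI) (auto intro: constants_closed)
qed (auto intro: constants_inv)

text \<open>The point is surjectivity of \<open>\<sigma>\<close> on constants: if
  \<open>\<sigma> x\<close> is constant, then
  \<open>\<sigma> (D x) = D (\<sigma> x) = \<zero>\<close>, and injectivity of
  \<open>\<sigma>\<close> gives \<open>D x = \<zero>\<close>.\<close>

lemma difference_field_constants: "difference_field (K\<lparr>carrier := constants\<rparr>) \<sigma>"
proof (rule difference_field_sub[OF subfield_constants])
  show "\<sigma> ` constants = constants"
  proof (intro equalityI subsetI)
    fix y assume "y \<in> constants"
    then have y: "y \<in> carrier K" "D y = \<zero>" by (simp_all add: constants_def)
    then obtain x where x: "x \<in> carrier K" "\<sigma> x = y" using s_surj by blast
    then have "\<sigma> (D x) = \<zero>" using y d_commute[of x] by simp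
    then have "x \<in> constants" using x d_closed s_zero_iff by (simp add: constants_def)
    then show "y \<in> \<sigma> ` constants" using x by blast
  qed (auto intro: constants_closed)
qed

end

section \<open>Linear maps over the constants from K to the extension L\<close>

locale constant_extension =
  difference_differential_field K \<sigma> D + L: difference_field L \<tau>
  for K :: "'a ring" (structure) and \<sigma> D and L :: "'b ring" and \<tau> +
  fixes h :: "'a \<Rightarrow> 'b"
  assumes h_hom: "h \<in> ring_hom (constant_field K D) L"
    and h_commute: "\<lbrakk>c \<in> carrier K; D c = \<zero>\<rbrakk> \<Longrightarrow> h (\<sigma> c) = \<tau> (h c)"
begin

lemma h_simps:
  "c \<in> constants \<Longrightarrow> h c \<in> carrier L"
  "\<lbrakk>c \<in> constants; d \<in> constants\<rbrakk> \<Longrightarrow> h (c \<oplus> d) = h c \<oplus>\<^bsub>L\<^esub> h d"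
  "\<lbrakk>c \<in> constants; d \<in> constants\<rbrakk> \<Longrightarrow> h (c \<otimes> d) = h c \<otimes>\<^bsub>L\<^esub> h d"
  "h \<one> = \<one>\<^bsub>L\<^esub>"
  "c \<in> constants \<Longrightarrow> h (\<sigma> c) = \<tau> (h c)"
  using ring_hom_memE[OF h_hom] h_commute by (auto simp: constant_field_def constants_def)

lemma h_zero: "h \<zero> = \<zero>\<^bsub>L\<^esub>"
proof -
  have "h \<zero> = h \<zero> \<oplus>\<^bsub>L\<^esub> h \<zero>" using h_simps(2)[of \<zero> \<zero>] constants_closed(2) by simp
  then show ?thesis using h_simps(1)[OF constants_closed(2)] by (metis L.add.l_cancel_one')
qed

lemma h_minus: "c \<in> constants \<Longrightarrow> h (\<ominus> c) = \<ominus>\<^bsub>L\<^esub> h c"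
  by (metis L.minus_equality constants_closed(1,6) h_simps(1,2) h_zero l_neg)

text \<open>An L-linear functional on the tensor product is determined by its values on K, so these
  maps form its L-linear dual. They are extensional, which makes equality a pointwise statement on
  \<open>carrier K\<close>.\<close>

definition duals :: "('a \<Rightarrow> 'b) set" where
  "duals = {f \<in> carrier K \<rightarrow>\<^sub>E carrier L.
    (\<forall>x\<in>carrier K. \<forall>y\<in>carrier K. f (x \<oplus> y) = f x \<oplus>\<^bsub>L\<^esub> f y) \<and>
    (\<forall>c\<in>constants. \<forall>x\<in>carrier K. f (c \<otimes> x) = h c \<otimes>\<^bsub>L\<^esub> f x)}"

lemma dualsI:
  assumes "\<And>x. x \<in> carrier K \<Longrightarrow> f x \<in> carrier L"
    and "\<And>x y. \<lbrakk>x \<in> carrier K; y \<in> carrier K\<rbrakk> \<Longrightarrow> f (x \<oplus> y) = f x \<oplus>\<^bsub>L\<^esub> f y"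
    and "\<And>c x. \<lbrakk>c \<in> constants; x \<in> carrier K\<rbrakk> \<Longrightarrow> f (c \<otimes> x) = h c \<otimes>\<^bsub>L\<^esub> f x"
  shows "(\<lambda>x\<in>carrier K. f x) \<in> duals"
  using assms by (auto simp: duals_def constants_closed)

lemma duals_simps:
  assumes "f \<in> duals"
  shows "x \<in> carrier K \<Longrightarrow> f x \<in> carrier L"
    and "\<lbrakk>x \<in> carrier K; y \<in> carrier K\<rbrakk> \<Longrightarrow> f (x \<oplus> y) = f x \<oplus>\<^bsub>L\<^esub> f y"
    and "\<lbrakk>c \<in> constants; x \<in> carrier K\<rbrakk> \<Longrightarrow> f (c \<otimes> x) = h c \<otimes>\<^bsub>L\<^esub> f x"
  using assms by (auto simp: duals_def)

lemma duals_eqI: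
  "\<lbrakk>f \<in> duals; g \<in> duals; \<And>x. x \<in> carrier K \<Longrightarrow> f x = g x\<rbrakk> \<Longrightarrow> f = g"
  by (auto simp: duals_def intro: PiE_ext)

lemma duals_zero: "f \<in> duals \<Longrightarrow> f \<zero> = \<zero>\<^bsub>L\<^esub>"
  using duals_simps(3)[of f \<zero> \<zero>] duals_simps(1)[of f \<zero>] constants_closed(2) h_zero by simp

text \<open>Zorn's lemma yields a complement \<open>M\<close> of the line of constants inside K,
  namely a maximal subspace over the constants that avoids \<open>\<one>\<close>. The functional is
  the projection along \<open>M\<close> followed by \<open>h\<close>. Its purpose is to show that
  the ring of operators is nonzero.\<close>

lemma dual_exists: "\<exists>f\<in>duals. f \<one> = \<one>\<^bsub>L\<^esub>"
proof -
  define A where "A = {H. H \<subseteq> carrier K \<and> \<zero> \<in> H \<and> \<one> \<notin> H \<and> (\<forall>x\<in>H. \<forall>y\<in>H. x \<oplus> y \<in> H) \<and>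
    (\<forall>c\<in>constants. \<forall>x\<in>H. c \<otimes> x \<in> H)}"
  have "\<exists>M\<in>A. \<forall>X\<in>A. M \<subseteq> X \<longrightarrow> X = M"
  proof (rule subset_Zorn_nonempty)
    have "{\<zero>} \<in> A" by (auto simp: A_def constants_closed)
    then show "A \<noteq> {}" by blast
    fix \<C> assume ne: "\<C> \<noteq> {}" and ch: "subset.chain A \<C>"
    have sub: "\<C> \<subseteq> A" using ch by (simp add: subset.chain_def)
    have "x \<oplus> y \<in> \<Union>\<C>" if "x \<in> \<Union>\<C>" "y \<in> \<Union>\<C>" for x y
    proof -
      from that obtain X Y where XY: "x \<in> X" "y \<in> Y" "X \<in> \<C>" "Y \<in> \<C>" by blast
      then have "X \<subseteq> Y \<or> Y \<subseteq> X" using ch by (auto simp: subset.chain_def)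
      then obtain Z where "x \<in> Z" "y \<in> Z" "Z \<in> \<C>" using XY by blast
      moreover then have "Z \<in> A" using sub by blast
      ultimately show ?thesis by (auto simp: A_def)
    qed
    moreover have "\<Union>\<C> \<subseteq> carrier K" "\<one> \<notin> \<Union>\<C>" using sub by (auto simp: A_def)
    moreover have "\<zero> \<in> \<Union>\<C>" using sub ne by (force simp: A_def)
    moreover have "c \<otimes> x \<in> \<Union>\<C>" if "c \<in> constants" "x \<in> \<Union>\<C>" for c x
      using that sub unfolding A_def by blast
    ultimately show "\<Union>\<C> \<in> A" by (simp add: A_def)
  qed
  then obtain M where M: "M \<in> A" and max: "\<And>X. \<lbrakk>X \<in> A; M \<subseteq> X\<rbrakk> \<Longrightarrow> X = M" by blast
  have Mc: "M \<subseteq> carrier K" "\<zero> \<in> M" "\<one> \<notin> M" "\<And>x y. \<lbrakk>x \<in> M; y \<in> M\<rbrakk> \<Longrightarrow> x \<oplus> y \<in> M"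
    "\<And>c x. \<lbrakk>c \<in> constants; x \<in> M\<rbrakk> \<Longrightarrow> c \<otimes> x \<in> M"
    using M by (auto simp: A_def)
  have neg: "\<ominus> x \<in> M" if "x \<in> M" for x
    using Mc(5)[of "\<ominus> \<one>" x] that Mc(1) constants_closed by (auto simp: l_minus)
  have ex: "\<exists>c\<in>constants. x \<ominus> c \<in> M" if x: "x \<in> carrier K" for x
  proof (cases "x \<in> M")
    case True
    then show ?thesis using x constants_closed by (intro bexI[of _ \<zero>]) (auto simp: minus_eq)
  next
    case False
    \<comment> \<open>The span of \<open>M\<close> and \<open>x\<close> is strictly larger than
      \<open>M\<close>, so by maximality it contains \<open>\<one>\<close>. In
      \<open>\<one> = m \<oplus> c \<otimes> x\<close> the constant \<open>c\<close> is nonzero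
      because \<open>\<one>\<close> is not in \<open>M\<close>; dividing by it shows that
      \<open>x\<close> is congruent to \<open>inv c\<close> modulo \<open>M\<close>.\<close>
    let ?X = "{m \<oplus> c \<otimes> x | m c. m \<in> M \<and> c \<in> constants}"
    have 1: "M \<subseteq> ?X"
    proof
      fix m assume "m \<in> M"
      then show "m \<in> ?X" using x Mc(1) constants_closed(2)
        by (intro CollectI exI[of _ m] exI[of _ \<zero>]) auto
    qed
    have "x \<in> ?X" using x Mc(2) constants_closed(3)
      by (intro CollectI exI[of _ \<zero>] exI[of _ \<one>]) auto
    then have "?X \<notin> A" using max[OF _ 1] False by blast
    moreover have "?X \<subseteq> carrier K" using x Mc(1) constants_closed(1) by auto
    moreover have "\<zero> \<in> ?X" using 1 Mc(2) by blast
    moreover have "y \<oplus> z \<in> ?X" if yz: "y \<in> ?X" "z \<in> ?X" for y z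
    proof -
      from yz obtain m c m' c' where *: "m \<in> M" "c \<in> constants" "y = m \<oplus> c \<otimes> x"
        "m' \<in> M" "c' \<in> constants" "z = m' \<oplus> c' \<otimes> x" by blast
      moreover from * have "y \<oplus> z = (m \<oplus> m') \<oplus> (c \<oplus> c') \<otimes> x"
        using x Mc(1) constants_closed(1) by (simp add: subset_iff l_distr a_ac)
      ultimately show ?thesis using Mc(4) constants_closed(4) by blast
    qed
    moreover have "d \<otimes> y \<in> ?X" if dy: "d \<in> constants" "y \<in> ?X" for d y
    proof -
      from dy obtain m c where *: "m \<in> M" "c \<in> constants" "y = m \<oplus> c \<otimes> x" by blast
      moreover from * have "d \<otimes> y = d \<otimes> m \<oplus> (d \<otimes> c) \<otimes> x"
        using x dy Mc(1) constants_closed(1) by (simp add: subset_iff r_distr m_assoc)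
      ultimately show ?thesis using dy Mc(5) constants_closed(5) by blast
    qed
    ultimately have "\<one> \<in> ?X" unfolding A_def by blast
    then obtain m c where mc: "m \<in> M" "c \<in> constants" "\<one> = m \<oplus> c \<otimes> x" by blast
    have mK: "m \<in> carrier K" and cK: "c \<in> carrier K" using mc Mc(1) constants_closed(1) by auto
    have "c \<noteq> \<zero>" using mc x mK Mc(3) by auto
    then have ic: "inv c \<in> constants" "inv c \<in> carrier K" "inv c \<otimes> c = \<one>"
      using mc constants_inv constants_closed(1) cK field_Units by auto
    have "x = inv c \<otimes> (c \<otimes> x)" using ic cK x by (simp add: m_assoc[symmetric])
    also have "c \<otimes> x = \<one> \<ominus> m" unfolding mc(3) using mK cK x by algebra
    finally have "x \<ominus> inv c = \<ominus> (inv c \<otimes> m)" using ic mK x by algebra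
    then show ?thesis using ic neg Mc(5) mc by metis
  qed
  \<comment> \<open>Two candidates differ by a constant lying in \<open>M\<close>. Were it nonzero,
    scaling it by its inverse would put \<open>\<one>\<close> into \<open>M\<close>.\<close>
  have un: "c = d" if "c \<in> constants" "d \<in> constants" "x \<in> carrier K" "x \<ominus> c \<in> M" "x \<ominus> d \<in> M" for c d x
  proof (rule ccontr)
    assume "c \<noteq> d"
    have K: "c \<in> carrier K" "d \<in> carrier K" using that constants_closed(1) by auto
    let ?e = "d \<ominus> c"
    have "(x \<ominus> c) \<oplus> \<ominus> (x \<ominus> d) = ?e" using K that by algebra
    then have e: "?e \<in> M" using Mc(4) neg that by metis
    have "?e \<oplus> c = d" using K by algebra
    then have "?e \<noteq> \<zero>" using \<open>c \<noteq> d\<close> K by auto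
    moreover have "?e \<in> constants" using that by (simp add: constants_closed minus_eq)
    ultimately have "inv ?e \<otimes> ?e = \<one>" "inv ?e \<in> constants"
      using constants_inv field_Units constants_closed(1) by auto
    then show False using Mc(3) Mc(5)[OF _ e] by metis
  qed
  define p where "p x = (THE c. c \<in> constants \<and> x \<ominus> c \<in> M)" for x
  have p: "p x = c" if "c \<in> constants" "x \<ominus> c \<in> M" "x \<in> carrier K" for x c
    unfolding p_def using that un by blast
  have pc: "p x \<in> constants" "x \<ominus> p x \<in> M" if "x \<in> carrier K" for x
    using ex[OF that] p[OF _ _ that] by auto
  have "(\<lambda>x\<in>carrier K. h (p x)) \<in> duals"
  proof (rule dualsI)
    fix x assume x: "x \<in> carrier K"
    then show "h (p x) \<in> carrier L" using pc h_simps(1) by blast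
    { fix y assume y: "y \<in> carrier K"
      have "(x \<oplus> y) \<ominus> (p x \<oplus> p y) = (x \<ominus> p x) \<oplus> (y \<ominus> p y)"
        using x y pc(1)[OF x] pc(1)[OF y] constants_closed(1) by (simp add: minus_eq minus_add a_ac)
      then have "p (x \<oplus> y) = p x \<oplus> p y"
        using x y pc constants_closed(4) Mc(4) by (intro p) auto
      then show "h (p (x \<oplus> y)) = h (p x) \<oplus>\<^bsub>L\<^esub> h (p y)" using x y pc h_simps(2) by simp }
    { fix c assume c: "c \<in> constants"
      have "c \<otimes> x \<ominus> c \<otimes> p x = c \<otimes> (x \<ominus> p x)"
        using x c pc(1)[OF x] constants_closed(1) by (simp add: minus_eq r_distr r_minus)
      then have "p (c \<otimes> x) = c \<otimes> p x"
        using x c pc constants_closed(1,5) Mc(5) by (intro p) auto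
      then show "h (p (c \<otimes> x)) = h c \<otimes>\<^bsub>L\<^esub> h (p x)" using c x pc h_simps(3) by simp }
  qed
  moreover have "p \<one> = \<one>"
    using constants_closed(3) Mc(2) by (intro p) (auto simp: minus_eq r_neg)
  ultimately show ?thesis
    by (intro bexI[of _ "\<lambda>x\<in>carrier K. h (p x)"]) (simp_all add: h_simps(4))
qed

section \<open>Operations on the dual space\<close>

definition inv_s :: "'a \<Rightarrow> 'a" where "inv_s = inv_into (carrier K) \<sigma>"

definition inv_t :: "'b \<Rightarrow> 'b" where "inv_t = inv_into (carrier L) \<tau>"

lemma inv_s:
  assumes "x \<in> carrier K"
  shows "inv_s x \<in> carrier K" "\<sigma> (inv_s x) = x" "inv_s (\<sigma> x) = x"
  using assms ring_iso_memE(5)[OF automorphism] unfolding inv_s_def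
  by (simp_all add: bij_betw_inv_into_left bij_betw_inv_into_right bij_betwE[OF bij_betw_inv_into])

lemma inv_t:
  assumes "y \<in> carrier L"
  shows "inv_t y \<in> carrier L" "\<tau> (inv_t y) = y" "inv_t (\<tau> y) = y"
  using assms ring_iso_memE(5)[OF L.automorphism] unfolding inv_t_def
  by (simp_all add: bij_betw_inv_into_left bij_betw_inv_into_right bij_betwE[OF bij_betw_inv_into])

lemma inv_t_hom:
  assumes "x \<in> carrier L" "y \<in> carrier L"
  shows "inv_t (x \<oplus>\<^bsub>L\<^esub> y) = inv_t x \<oplus>\<^bsub>L\<^esub> inv_t y" "inv_t (x \<otimes>\<^bsub>L\<^esub> y) = inv_t x \<otimes>\<^bsub>L\<^esub> inv_t y"
  using inv_t(3)[of "inv_t x \<oplus>\<^bsub>L\<^esub> inv_t y"] inv_t(3)[of "inv_t x \<otimes>\<^bsub>L\<^esub> inv_t y"] assms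
  by (simp_all add: inv_t L.s_add L.s_mult)

definition dual_add :: "('a \<Rightarrow> 'b) \<Rightarrow> ('a \<Rightarrow> 'b) \<Rightarrow> 'a \<Rightarrow> 'b" where
  "dual_add f g = (\<lambda>x\<in>carrier K. f x \<oplus>\<^bsub>L\<^esub> g x)"

definition dual_zero :: "'a \<Rightarrow> 'b" where
  "dual_zero = (\<lambda>x\<in>carrier K. \<zero>\<^bsub>L\<^esub>)"

definition dual_minus :: "('a \<Rightarrow> 'b) \<Rightarrow> ('a \<Rightarrow> 'b) \<Rightarrow> 'a \<Rightarrow> 'b" where
  "dual_minus f g = (\<lambda>x\<in>carrier K. f x \<ominus>\<^bsub>L\<^esub> g x)"

definition dual_mult :: "'a \<Rightarrow> 'b \<Rightarrow> ('a \<Rightarrow> 'b) \<Rightarrow> 'a \<Rightarrow> 'b" where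
  "dual_mult k l f = (\<lambda>x\<in>carrier K. l \<otimes>\<^bsub>L\<^esub> f (k \<otimes> x))"

definition dual_d :: "('a \<Rightarrow> 'b) \<Rightarrow> 'a \<Rightarrow> 'b" where
  "dual_d f = (\<lambda>x\<in>carrier K. f (D x))"

definition dual_s :: "('a \<Rightarrow> 'b) \<Rightarrow> 'a \<Rightarrow> 'b" where
  "dual_s f = (\<lambda>x\<in>carrier K. \<tau> (f (inv_s x)))"

definition dual_s_inv :: "('a \<Rightarrow> 'b) \<Rightarrow> 'a \<Rightarrow> 'b" where
  "dual_s_inv f = (\<lambda>x\<in>carrier K. inv_t (f (\<sigma> x)))"

lemma inv_s_hom:
  assumes "x \<in> carrier K" "y \<in> carrier K"
  shows "inv_s (x \<oplus> y) = inv_s x \<oplus> inv_s y" "inv_s (x \<otimes> y) = inv_s x \<otimes> inv_s y"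
  using inv_s(3)[of "inv_s x \<oplus> inv_s y"] inv_s(3)[of "inv_s x \<otimes> inv_s y"] assms
  by (simp_all add: inv_s s_add s_mult)

lemma inv_s_constants:
  assumes "c \<in> constants"
  shows "inv_s c \<in> constants" "\<tau> (h (inv_s c)) = h c"
proof -
  have c: "c \<in> carrier K" using assms constants_closed(1) by blast
  have "\<sigma> (D (inv_s c)) = D c"
    using d_commute[of "inv_s c"] inv_s c by simp
  then show *: "inv_s c \<in> constants"
    using assms c inv_s d_closed s_zero_iff by (simp add: constants_def)
  then show "\<tau> (h (inv_s c)) = h c" using h_simps(5)[OF *] inv_s c by simp
qed

text \<open>Linearity over the constants survives \<open>dual_d\<close> because D is linear over its
  own constants. It survives \<open>dual_s\<close> and \<open>dual_s_inv\<close> because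
  \<open>h\<close> intertwines \<open>\<sigma>\<close> with \<open>\<tau>\<close>, so the twists on
  scalars and on values cancel.\<close>

lemma dual_closed:
  assumes f: "f \<in> duals"
  shows "g \<in> duals \<Longrightarrow> dual_add f g \<in> duals"
    and "g \<in> duals \<Longrightarrow> dual_minus f g \<in> duals"
    and "dual_zero \<in> duals"
    and "\<lbrakk>k \<in> carrier K; l \<in> carrier L\<rbrakk> \<Longrightarrow> dual_mult k l f \<in> duals"
    and "dual_d f \<in> duals"
    and "dual_s f \<in> duals"
    and "dual_s_inv f \<in> duals"
proof -
  note simps = duals_simps[OF f] constants_closed(1) h_simps
  show "dual_add f g \<in> duals" "dual_minus f g \<in> duals" if "g \<in> duals"
    unfolding dual_add_def dual_minus_def
    by (rule dualsI; simp add: simps duals_simps[OF that] L.cring_simprules)+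
  show "dual_zero \<in> duals"
    unfolding dual_zero_def by (rule dualsI; simp add: simps)
  show "dual_mult k l f \<in> duals" if kl: "k \<in> carrier K" "l \<in> carrier L"
    unfolding dual_mult_def
  proof (rule dualsI)
    fix c x assume c: "c \<in> constants" and x: "x \<in> carrier K"
    have "k \<otimes> (c \<otimes> x) = c \<otimes> (k \<otimes> x)" using kl c x constants_closed(1) by (simp add: m_lcomm)
    then show "l \<otimes>\<^bsub>L\<^esub> f (k \<otimes> (c \<otimes> x)) = h c \<otimes>\<^bsub>L\<^esub> (l \<otimes>\<^bsub>L\<^esub> f (k \<otimes> x))"
      using kl c x by (simp add: simps L.m_lcomm)
  qed (use kl in \<open>simp_all add: simps r_distr L.r_distr\<close>)
  show "dual_d f \<in> duals"
    unfolding dual_d_def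
  proof (rule dualsI)
    fix c x assume c: "c \<in> constants" and x: "x \<in> carrier K"
    then have "D (c \<otimes> x) = c \<otimes> D x"
      by (simp add: constants_def d_mult d_closed)
    then show "f (D (c \<otimes> x)) = h c \<otimes>\<^bsub>L\<^esub> f (D x)"
      using c x by (simp add: simps d_closed)
  qed (simp_all add: simps d_closed d_add)
  show "dual_s f \<in> duals"
    unfolding dual_s_def
    by (rule dualsI) (simp_all add: simps inv_s inv_s_hom inv_s_constants L.s_closed L.s_add L.s_mult)
  show "dual_s_inv f \<in> duals"
    unfolding dual_s_inv_def
  proof (rule dualsI)
    fix c x assume c: "c \<in> constants" and x: "x \<in> carrier K"
    then have "f (\<sigma> (c \<otimes> x)) = \<tau> (h c) \<otimes>\<^bsub>L\<^esub> f (\<sigma> x)"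
      by (simp add: simps s_mult s_closed constants_closed(7))
    then show "inv_t (f (\<sigma> (c \<otimes> x))) = h c \<otimes>\<^bsub>L\<^esub> inv_t (f (\<sigma> x))"
      using c x by (simp add: simps inv_t inv_t_hom s_closed L.s_closed)
  qed (simp_all add: simps s_closed s_add inv_t inv_t_hom)
qed

section \<open>Operators on the dual space and pure tensors\<close>

definition operators :: "(('a \<Rightarrow> 'b) \<Rightarrow> 'a \<Rightarrow> 'b) set" where
  "operators = duals \<rightarrow>\<^sub>E duals"

definition pure :: "'a \<Rightarrow> 'b \<Rightarrow> ('a \<Rightarrow> 'b) \<Rightarrow> 'a \<Rightarrow> 'b" where
  "pure k l = (\<lambda>f\<in>duals. dual_mult k l f)"

definition op_add (infixl "[+]" 65) where
  "u [+] v = (\<lambda>f\<in>duals. dual_add (u f) (v f))"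

definition op_zero where
  "op_zero = (\<lambda>f\<in>duals. dual_zero)"

definition op_mult (infixl "[*]" 70) where
  "u [*] v = (\<lambda>f\<in>duals. u (v f))"

text \<open>Since \<open>dual_d\<close> is precomposition with D, the commutator is taken in this
  order: on a pure tensor it produces \<open>D (k \<otimes> x) \<ominus> k \<otimes> D x = D k
  \<otimes> x\<close> in the argument of the functional, hence the derivation that acts on the left
  factor and kills the right one.\<close>

definition op_d where
  "op_d u = (\<lambda>f\<in>duals. dual_minus (u (dual_d f)) (dual_d (u f)))"

definition op_s where
  "op_s u = (\<lambda>f\<in>duals. dual_s (u (dual_s_inv f)))"

lemma operators_app: "\<lbrakk>u \<in> operators; f \<in> duals\<rbrakk> \<Longrightarrow> u f \<in> duals"
  by (auto simp: operators_def)

lemma operators_eqI: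
  assumes "u \<in> operators" "v \<in> operators"
    and "\<And>f x. \<lbrakk>f \<in> duals; x \<in> carrier K\<rbrakk> \<Longrightarrow> u f x = v f x"
  shows "u = v"
proof (rule PiE_ext)
  show "u \<in> duals \<rightarrow>\<^sub>E duals" "v \<in> duals \<rightarrow>\<^sub>E duals" using assms by (auto simp: operators_def)
  show "u f = v f" if "f \<in> duals" for f
    using that assms by (blast intro: duals_eqI operators_app)
qed

lemma op_closed:
  "\<lbrakk>k \<in> carrier K; l \<in> carrier L\<rbrakk> \<Longrightarrow> pure k l \<in> operators"
  "\<lbrakk>u \<in> operators; v \<in> operators\<rbrakk> \<Longrightarrow> u [+] v \<in> operators"
  "op_zero \<in> operators"
  "\<lbrakk>u \<in> operators; v \<in> operators\<rbrakk> \<Longrightarrow> u [*] v \<in> operators"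
  "u \<in> operators \<Longrightarrow> op_d u \<in> operators"
  "u \<in> operators \<Longrightarrow> op_s u \<in> operators"
  unfolding operators_def pure_def op_add_def op_zero_def op_mult_def op_d_def op_s_def
  by (auto intro!: dual_closed)

lemma op_apply:
  "\<lbrakk>f \<in> duals; x \<in> carrier K\<rbrakk> \<Longrightarrow> pure k l f x = l \<otimes>\<^bsub>L\<^esub> f (k \<otimes> x)"
  "\<lbrakk>f \<in> duals; x \<in> carrier K\<rbrakk> \<Longrightarrow> (u [+] v) f x = u f x \<oplus>\<^bsub>L\<^esub> v f x"
  "\<lbrakk>f \<in> duals; x \<in> carrier K\<rbrakk> \<Longrightarrow> op_zero f x = \<zero>\<^bsub>L\<^esub>"
  "f \<in> duals \<Longrightarrow> (u [*] v) f = u (v f)"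
  "\<lbrakk>f \<in> duals; x \<in> carrier K\<rbrakk> \<Longrightarrow> op_d u f x = u (dual_d f) x \<ominus>\<^bsub>L\<^esub> u f (D x)"
  "\<lbrakk>f \<in> duals; x \<in> carrier K\<rbrakk> \<Longrightarrow> op_s u f x = \<tau> (u (dual_s_inv f) (inv_s x))"
  by (simp_all add: pure_def op_add_def op_zero_def op_mult_def op_d_def op_s_def dual_mult_def
      dual_add_def dual_zero_def dual_minus_def dual_d_def dual_s_def)

lemma op_val: "\<lbrakk>u \<in> operators; f \<in> duals; x \<in> carrier K\<rbrakk> \<Longrightarrow> u f x \<in> carrier L"
  using operators_app duals_simps(1) by blast

lemmas op_simps = op_apply op_closed op_val operators_app dual_closed

lemma op_add_assoc: "\<lbrakk>u \<in> operators; v \<in> operators; w \<in> operators\<rbrakk> \<Longrightarrow> u [+] v [+] w = u [+] (v [+] w)"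
  by (rule operators_eqI) (simp_all add: op_simps L.a_assoc)

lemma op_add_comm: "\<lbrakk>u \<in> operators; v \<in> operators\<rbrakk> \<Longrightarrow> u [+] v = v [+] u"
  by (rule operators_eqI) (simp_all add: op_simps L.a_comm)

lemma op_add_lcomm:
  "\<lbrakk>u \<in> operators; v \<in> operators; w \<in> operators\<rbrakk> \<Longrightarrow> u [+] (v [+] w) = v [+] (u [+] w)"
  by (rule operators_eqI) (simp_all add: op_simps L.a_lcomm)

lemma op_add_zero: "u \<in> operators \<Longrightarrow> op_zero [+] u = u"
  by (rule operators_eqI) (simp_all add: op_simps)

lemma op_mult_assoc:
  "\<lbrakk>u \<in> operators; v \<in> operators; w \<in> operators\<rbrakk> \<Longrightarrow> u [*] v [*] w = u [*] (v [*] w)"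
  by (rule operators_eqI) (simp_all add: op_simps)

lemma op_l_distr:
  "\<lbrakk>u \<in> operators; v \<in> operators; w \<in> operators\<rbrakk> \<Longrightarrow> (u [+] v) [*] w = u [*] w [+] v [*] w"
  by (rule operators_eqI) (simp_all add: op_simps)

lemma op_zero_mult: "u \<in> operators \<Longrightarrow> op_zero [*] u = op_zero"
  by (rule operators_eqI) (simp_all add: op_simps)

lemma pure_add_left:
  "\<lbrakk>k \<in> carrier K; k' \<in> carrier K; l \<in> carrier L\<rbrakk> \<Longrightarrow> pure (k \<oplus> k') l = pure k l [+] pure k' l"
  by (rule operators_eqI) (simp_all add: op_simps l_distr L.r_distr duals_simps)

lemma pure_add_right:
  "\<lbrakk>k \<in> carrier K; l \<in> carrier L; l' \<in> carrier L\<rbrakk> \<Longrightarrow> pure k (l \<oplus>\<^bsub>L\<^esub> l') = pure k l [+] pure k l'"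
  by (rule operators_eqI) (simp_all add: op_simps L.l_distr duals_simps)

lemma pure_zero_left: "l \<in> carrier L \<Longrightarrow> pure \<zero> l = op_zero"
  by (rule operators_eqI) (simp_all add: op_simps duals_zero)

lemma pure_zero_right: "k \<in> carrier K \<Longrightarrow> pure k \<zero>\<^bsub>L\<^esub> = op_zero"
  by (rule operators_eqI) (simp_all add: op_simps duals_simps)

text \<open>The balancing relation of a tensor product over the constants; it reflects the linearity
  of the functionals.\<close>

lemma pure_constant:
  "\<lbrakk>k \<in> carrier K; c \<in> constants; l \<in> carrier L\<rbrakk> \<Longrightarrow> pure (k \<otimes> c) l = pure k (h c \<otimes>\<^bsub>L\<^esub> l)"
proof (rule operators_eqI)
  fix f x assume *: "k \<in> carrier K" "c \<in> constants" "l \<in> carrier L" "f \<in> duals" "x \<in> carrier K"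
  moreover from * have "k \<otimes> c \<otimes> x = c \<otimes> (k \<otimes> x)" using constants_closed(1) by (simp add: m_ac)
  ultimately show "pure (k \<otimes> c) l f x = pure k (h c \<otimes>\<^bsub>L\<^esub> l) f x"
    by (simp add: op_simps duals_simps h_simps L.m_ac)
qed (auto intro: op_closed simp: constants_closed h_simps)

lemma pure_mult:
  "\<lbrakk>k \<in> carrier K; k' \<in> carrier K; l \<in> carrier L; l' \<in> carrier L\<rbrakk> \<Longrightarrow>
    pure k l [*] pure k' l' = pure (k \<otimes> k') (l \<otimes>\<^bsub>L\<^esub> l')"
proof (rule operators_eqI)
  fix f x
  assume *: "k \<in> carrier K" "k' \<in> carrier K" "l \<in> carrier L" "l' \<in> carrier L" "f \<in> duals" "x \<in> carrier K"
  have "pure k' l' f \<in> duals" using * by (simp add: op_simps)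
  with * show "(pure k l [*] pure k' l') f x = pure (k \<otimes> k') (l \<otimes>\<^bsub>L\<^esub> l') f x"
    by (simp add: op_apply duals_simps m_ac L.m_ac)
qed (auto intro: op_closed)

lemma pure_one_mult: "u \<in> operators \<Longrightarrow> pure \<one> \<one>\<^bsub>L\<^esub> [*] u = u"
  by (rule operators_eqI) (simp_all add: op_simps)

section \<open>The commutative ring generated by pure tensors\<close>

inductive_set tensors :: "(('a \<Rightarrow> 'b) \<Rightarrow> 'a \<Rightarrow> 'b) set" where
  zero: "op_zero \<in> tensors"
| add: "\<lbrakk>k \<in> carrier K; l \<in> carrier L; u \<in> tensors\<rbrakk> \<Longrightarrow> pure k l [+] u \<in> tensors"

lemma tensors_op: "u \<in> tensors \<Longrightarrow> u \<in> operators"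
  by (induction rule: tensors.induct) (simp_all add: op_closed)

lemma pure_tensors: "\<lbrakk>k \<in> carrier K; l \<in> carrier L\<rbrakk> \<Longrightarrow> pure k l \<in> tensors"
  using tensors.add[OF _ _ tensors.zero, of k l] by (simp add: op_add_comm op_add_zero op_closed)

lemma tensors_add: "u \<in> tensors \<Longrightarrow> v \<in> tensors \<Longrightarrow> u [+] v \<in> tensors"
  by (induction rule: tensors.induct)
    (simp_all add: op_add_zero tensors_op op_add_assoc op_closed tensors.add)

text \<open>Operators are arbitrary maps on the dual space, so only distributivity on the other side
  holds for all of them. This one comes from the additivity of the action of a pure tensor, and it
  extends to sums by induction.\<close>

lemma tensors_additive:
  assumes "u \<in> tensors" "v \<in> operators" "w \<in> operators"
  shows "u [*] (v [+] w) = u [*] v [+] u [*] w"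
  using assms(1)
proof (induction rule: tensors.induct)
  case zero
  show ?case by (rule operators_eqI) (simp_all add: op_simps assms(2,3))
next
  case (add k l u)
  have "pure k l [*] (v [+] w) = pure k l [*] v [+] pure k l [*] w"
  proof (rule operators_eqI)
    fix f x assume *: "f \<in> duals" "x \<in> carrier K"
    have "(v [+] w) f \<in> duals" "v f \<in> duals" "w f \<in> duals"
      using * assms op_closed(2) operators_app by blast+
    with * add(1,2) show "(pure k l [*] (v [+] w)) f x = (pure k l [*] v [+] pure k l [*] w) f x"
      by (simp add: op_apply L.r_distr duals_simps)
  qed (use add assms in \<open>simp_all add: op_closed\<close>)
  then show ?case
    using add.IH add.hyps assms(2,3) tensors_op[OF add(3)]
    by (simp add: op_l_distr op_closed op_add_assoc op_add_lcomm)
qed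

lemma tensors_mult_zero:
  assumes "u \<in> tensors" shows "u [*] op_zero = op_zero"
  using assms
proof (induction rule: tensors.induct)
  case zero
  show ?case by (simp add: op_zero_mult op_closed)
next
  case (add k l u)
  have "pure k l [*] op_zero = op_zero"
  proof (rule operators_eqI)
    fix f x assume *: "f \<in> duals" "x \<in> carrier K"
    have "op_zero f \<in> duals" using * operators_app op_closed(3) by blast
    with * add(1,2) show "(pure k l [*] op_zero) f x = op_zero f x"
      by (simp add: op_apply)
  qed (use add in \<open>simp_all add: op_closed\<close>)
  then show ?case
    using add.IH add.hyps tensors_op[OF add(3)]
    by (simp add: op_l_distr op_closed op_add_zero)
qed

lemma pure_mult_comm:
  assumes "u \<in> tensors" "k \<in> carrier K" "l \<in> carrier L"
  shows "pure k l [*] u = u [*] pure k l"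
  using assms(1)
proof (induction rule: tensors.induct)
  case zero
  show ?case using assms by (simp add: op_zero_mult op_closed tensors_mult_zero pure_tensors)
next
  case (add k' l' u)
  then have "pure k l [*] (pure k' l' [+] u) = pure k l [*] pure k' l' [+] pure k l [*] u"
    using assms by (intro tensors_additive) (simp_all add: pure_tensors op_closed tensors_op)
  then show ?case
    using add assms by (simp add: op_l_distr op_closed tensors_op pure_mult m_comm L.m_comm)
qed

lemma tensors_comm:
  assumes "u \<in> tensors" "v \<in> tensors"
  shows "u [*] v = v [*] u"
  using assms(1)
proof (induction rule: tensors.induct)
  case zero
  show ?case using assms by (simp add: op_zero_mult tensors_op tensors_mult_zero)
next
  case (add k l u)
  then show ?case
    using assms(2) by (simp add: op_l_distr op_closed tensors_op pure_mult_comm tensors_additive)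
qed

lemma pure_mult_tensors: "u \<in> tensors \<Longrightarrow> k \<in> carrier K \<Longrightarrow> l \<in> carrier L \<Longrightarrow> pure k l [*] u \<in> tensors"
  by (induction rule: tensors.induct)
    (simp_all add: tensors_mult_zero pure_tensors tensors.zero tensors_additive op_closed tensors_op
      pure_mult tensors_add)

lemma tensors_mult: "u \<in> tensors \<Longrightarrow> v \<in> tensors \<Longrightarrow> u [*] v \<in> tensors"
  by (induction rule: tensors.induct)
    (simp_all add: op_zero_mult tensors_op tensors.zero op_l_distr op_closed tensors_add
      pure_mult_tensors)

text \<open>The image of the tensor product over the constants in the ring of operators. Induction
  over finite sums of pure tensors takes the place of the universal property.\<close>

definition tensor_ring :: "(('a \<Rightarrow> 'b) \<Rightarrow> 'a \<Rightarrow> 'b) ring" where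
  "tensor_ring = \<lparr>carrier = tensors, mult = op_mult, one = pure \<one> \<one>\<^bsub>L\<^esub>, zero = op_zero, add = op_add\<rparr>"

lemma tensor_ring_simps [simp]:
  "carrier tensor_ring = tensors" "mult tensor_ring = op_mult"
  "one tensor_ring = pure \<one> \<one>\<^bsub>L\<^esub>" "zero tensor_ring = op_zero" "add tensor_ring = op_add"
  by (simp_all add: tensor_ring_def)

lemma cring_tensor_ring: "cring tensor_ring"
proof (rule cringI)
  show "abelian_group tensor_ring"
  proof (rule abelian_groupI)
    fix u assume u: "u \<in> carrier tensor_ring"
    have m: "\<ominus> \<one> \<in> carrier K" "\<one> \<in> carrier K" "\<one>\<^bsub>L\<^esub> \<in> carrier L" by simp_all
    have "pure (\<ominus> \<one>) \<one>\<^bsub>L\<^esub> [*] u [+] pure \<one> \<one>\<^bsub>L\<^esub> [*] u = (pure (\<ominus> \<one>) \<one>\<^bsub>L\<^esub> [+] pure \<one> \<one>\<^bsub>L\<^esub>) [*] u"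
      using u by (simp add: op_l_distr op_closed tensors_op)
    also have "pure (\<ominus> \<one>) \<one>\<^bsub>L\<^esub> [+] pure \<one> \<one>\<^bsub>L\<^esub> = op_zero"
      using pure_add_left[OF m] by (simp add: l_neg pure_zero_left)
    finally show "\<exists>v\<in>carrier tensor_ring. v \<oplus>\<^bsub>tensor_ring\<^esub> u = \<zero>\<^bsub>tensor_ring\<^esub>"
      using u m by (intro bexI[of _ "pure (\<ominus> \<one>) \<one>\<^bsub>L\<^esub> [*] u"])
        (simp_all add: op_zero_mult tensors_op pure_one_mult pure_mult_tensors)
  qed (auto intro: op_add_comm simp: tensors_add tensors.zero op_add_assoc op_add_zero tensors_op)
  show "comm_monoid tensor_ring"
    by (rule comm_monoidI)
      (auto intro: tensors_comm simp: tensors_mult pure_tensors op_mult_assoc tensors_op pure_one_mult)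
qed (simp add: op_l_distr tensors_op)

sublocale T: cring tensor_ring
  by (rule cring_tensor_ring)

section \<open>The derivation on the tensor ring\<close>

lemma op_d_pure:
  assumes "k \<in> carrier K" "l \<in> carrier L"
  shows "op_d (pure k l) = pure (D k) l"
proof (rule operators_eqI)
  fix f x assume *: "f \<in> duals" "x \<in> carrier K"
  then have "dual_d f \<in> duals" by (simp add: dual_closed)
  with * have 1: "op_d (pure k l) f x = l \<otimes>\<^bsub>L\<^esub> f (D (k \<otimes> x)) \<ominus>\<^bsub>L\<^esub> l \<otimes>\<^bsub>L\<^esub> f (k \<otimes> D x)"
    using assms by (simp add: op_apply d_closed) (simp add: dual_d_def)
  have "f (D (k \<otimes> x)) = f (D k \<otimes> x) \<oplus>\<^bsub>L\<^esub> f (k \<otimes> D x)"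
    using * assms by (simp add: d_mult duals_simps d_closed)
  moreover have "f (D k \<otimes> x) \<in> carrier L" "f (k \<otimes> D x) \<in> carrier L"
    using * assms by (simp_all add: duals_simps d_closed)
  moreover have "l \<otimes>\<^bsub>L\<^esub> (y \<oplus>\<^bsub>L\<^esub> z) \<ominus>\<^bsub>L\<^esub> l \<otimes>\<^bsub>L\<^esub> z = l \<otimes>\<^bsub>L\<^esub> y"
    if "y \<in> carrier L" "z \<in> carrier L" for y z
    using assms that by (simp add: L.cring_simprules)
  ultimately show "op_d (pure k l) f x = pure (D k) l f x"
    using * 1 by (simp add: op_apply)
qed (use assms in \<open>simp_all add: op_closed d_closed\<close>)

lemma op_d_add:
  assumes u: "u \<in> operators" and v: "v \<in> operators"
  shows "op_d (u [+] v) = op_d u [+] op_d v"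
proof (rule operators_eqI)
  fix f x assume *: "f \<in> duals" "x \<in> carrier K"
  then have "dual_d f \<in> duals" by (simp add: dual_closed)
  with * show "op_d (u [+] v) f x = (op_d u [+] op_d v) f x"
    using u v by (simp add: op_apply d_closed op_val L.minus_eq L.minus_add L.a_ac)
qed (use assms in \<open>simp_all add: op_closed\<close>)

lemma op_d_zero: "op_d op_zero = op_zero"
  using op_d_pure[of \<zero> "\<zero>\<^bsub>L\<^esub>"] by (simp add: pure_zero_left d_zero)

lemma op_d_tensors: "u \<in> tensors \<Longrightarrow> op_d u \<in> tensors"
  by (induction rule: tensors.induct)
    (simp_all add: op_d_zero tensors.zero op_d_add op_d_pure op_closed tensors_op tensors.add d_closed)

lemma op_d_pure_mult:
  assumes "u \<in> tensors" "k \<in> carrier K" "l \<in> carrier L"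
  shows "op_d (pure k l [*] u) = op_d (pure k l) [*] u [+] pure k l [*] op_d u"
  using assms(1)
proof (induction rule: tensors.induct)
  case zero
  then show ?case using assms
    by (simp add: tensors_mult_zero pure_tensors op_d_zero op_d_pure d_closed op_add_zero op_closed)
next
  case (add k' l' u)
  note kl = pure_tensors[OF assms(2,3)] pure_tensors[OF add(1,2)] pure_tensors[OF d_closed[OF assms(2)] assms(3)]
    pure_tensors[OF d_closed[OF add(1)] add(2)]
  have "op_d (pure k l [*] pure k' l') = pure (D k) l [*] pure k' l' [+] pure k l [*] pure (D k') l'"
    using add assms by (simp add: pure_mult op_d_pure d_mult pure_add_left d_closed)
  then show ?case
    using kl add op_d_tensors[OF add(3)] assms
    by (simp add: tensors_additive op_closed tensors_op op_d_add op_d_pure d_closed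
        op_add_assoc op_add_lcomm)
qed

text \<open>A commutator satisfies the Leibniz rule only when the left factor is additive. Induction
  over tensors supplies this and reduces the claim to pure tensors, where it is the Leibniz rule of
  D.\<close>

lemma op_d_mult:
  assumes "u \<in> tensors" "v \<in> tensors"
  shows "op_d (u [*] v) = op_d u [*] v [+] u [*] op_d v"
  using assms(1)
proof (induction rule: tensors.induct)
  case zero
  then show ?case using assms(2)
    by (simp add: op_zero_mult tensors_op op_d_tensors op_d_zero op_add_zero op_closed)
next
  case (add k l u)
  then show ?case
    using op_d_tensors[OF add(3)] op_d_tensors[OF assms(2)] assms(2)
    by (simp add: op_l_distr op_closed tensors_op op_d_add op_d_pure_mult
        op_add_assoc op_add_lcomm)
qed

sublocale T: differential_ring tensor_ring op_d
  by unfold_locales (simp_all add: op_d_tensors op_d_add tensors_op op_d_mult)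

section \<open>The automorphism of the tensor ring\<close>

lemma op_s_pure:
  assumes "k \<in> carrier K" "l \<in> carrier L"
  shows "op_s (pure k l) = pure (\<sigma> k) (\<tau> l)"
proof (rule operators_eqI)
  fix f x assume *: "f \<in> duals" "x \<in> carrier K"
  then have "dual_s_inv f \<in> duals" by (simp add: dual_closed)
  with * have "op_s (pure k l) f x = \<tau> (l \<otimes>\<^bsub>L\<^esub> inv_t (f (\<sigma> (k \<otimes> inv_s x))))"
    using assms by (simp add: op_apply inv_s) (simp add: dual_s_inv_def inv_s)
  then show "op_s (pure k l) f x = pure (\<sigma> k) (\<tau> l) f x"
    using * assms by (simp add: op_apply s_mult inv_s L.s_mult inv_t s_closed duals_simps)
qed (use assms in \<open>simp_all add: op_closed s_closed L.s_closed\<close>)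

lemma op_s_add:
  assumes u: "u \<in> operators" and v: "v \<in> operators"
  shows "op_s (u [+] v) = op_s u [+] op_s v"
proof (rule operators_eqI)
  fix f x assume *: "f \<in> duals" "x \<in> carrier K"
  then have "dual_s_inv f \<in> duals" by (simp add: dual_closed)
  with * show "op_s (u [+] v) f x = (op_s u [+] op_s v) f x"
    using u v by (simp add: op_apply inv_s op_val L.s_add)
qed (use assms in \<open>simp_all add: op_closed\<close>)

text \<open>Conjugation is multiplicative because the inner \<open>dual_s_inv\<close> undoes the
  inner \<open>dual_s\<close>.\<close>

lemma op_s_mult:
  assumes u: "u \<in> operators" and v: "v \<in> operators"
  shows "op_s (u [*] v) = op_s u [*] op_s v"
proof (rule operators_eqI)
  fix f x assume *: "f \<in> duals" "x \<in> carrier K"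
  then have f: "dual_s_inv f \<in> duals" by (simp add: dual_closed)
  have w: "v (dual_s_inv f) \<in> duals" using v f operators_app by blast
  have "dual_s_inv (op_s v f) = v (dual_s_inv f)"
  proof (rule duals_eqI)
    show "dual_s_inv (op_s v f) \<in> duals" using * v by (simp add: dual_closed op_closed operators_app)
    fix y assume y: "y \<in> carrier K"
    then show "dual_s_inv (op_s v f) y = v (dual_s_inv f) y"
      using * w by (simp add: dual_s_inv_def[of "op_s v f"] op_apply s_closed inv_s inv_t duals_simps)
  qed (rule w)
  moreover have "op_s v f \<in> duals" using * v by (simp add: op_closed operators_app)
  ultimately show "op_s (u [*] v) f x = (op_s u [*] op_s v) f x"
    using * f by (simp add: op_apply)
qed (use assms in \<open>simp_all add: op_closed\<close>)

lemma op_s_zero: "op_s op_zero = op_zero"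
  using op_s_pure[of \<zero> "\<zero>\<^bsub>L\<^esub>"] by (simp add: pure_zero_left s_zero L.s_zero)

lemma op_s_tensors: "u \<in> tensors \<Longrightarrow> op_s u \<in> tensors"
  by (induction rule: tensors.induct)
    (simp_all add: op_s_zero tensors.zero op_s_add op_s_pure op_closed tensors_op tensors.add
      s_closed L.s_closed)

text \<open>Evaluating the conjugate of \<open>u\<close> at \<open>dual_s f\<close> and
  \<open>\<sigma> x\<close> gives \<open>\<tau> (u f x)\<close>, from which \<open>u f x\<close> is
  recovered.\<close>

lemma op_s_inj:
  assumes u: "u \<in> operators" and v: "v \<in> operators" and eq: "op_s u = op_s v"
  shows "u = v"
proof (rule operators_eqI)
  fix f x assume *: "f \<in> duals" "x \<in> carrier K"
  then have g: "dual_s f \<in> duals" by (simp add: dual_closed)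
  have "dual_s_inv (dual_s f) = f"
  proof (rule duals_eqI)
    show "dual_s_inv (dual_s f) \<in> duals" using * by (simp add: dual_closed)
    show "dual_s_inv (dual_s f) y = f y" if "y \<in> carrier K" for y
      using that * by (simp add: dual_s_inv_def dual_s_def s_closed inv_s inv_t duals_simps)
  qed (use * in simp)
  then have "op_s w (dual_s f) (\<sigma> x) = \<tau> (w f x)" for w
    using g * by (simp add: op_apply s_closed inv_s)
  then have "\<tau> (u f x) = \<tau> (v f x)" using eq by metis
  then show "u f x = v f x" using * u v by (simp add: L.s_inj op_val)
qed (use assms in simp_all)

lemma op_s_surj: "v \<in> tensors \<Longrightarrow> v \<in> op_s ` tensors"
proof (induction rule: tensors.induct)
  case zero
  then show ?case using op_s_zero tensors.zero by (metis imageI)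
next
  case (add k l v)
  then obtain u where u: "u \<in> tensors" "v = op_s u" by blast
  have "op_s (pure (inv_s k) (inv_t l) [+] u) = pure k l [+] v"
    using u add by (simp add: op_s_add op_s_pure op_closed inv_s inv_t tensors_op)
  moreover have "pure (inv_s k) (inv_t l) [+] u \<in> tensors"
    using u add by (simp add: tensors.add inv_s inv_t)
  ultimately show ?case by (metis imageI)
qed

lemma op_s_iso: "op_s \<in> ring_iso tensor_ring tensor_ring"
proof (rule ring_iso_memI)
  show "bij_betw op_s (carrier tensor_ring) (carrier tensor_ring)"
    using op_s_inj op_s_surj op_s_tensors tensors_op by (auto simp: bij_betw_def inj_on_def)
qed (simp_all add: op_s_tensors op_s_add op_s_mult tensors_op op_s_pure s_one L.s_one)

lemma op_d_s_commute: "u \<in> tensors \<Longrightarrow> op_d (op_s u) = op_s (op_d u)"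
  by (induction rule: tensors.induct)
    (simp_all add: op_d_zero op_s_zero op_d_add op_s_add op_d_pure op_s_pure op_closed tensors_op
      s_closed L.s_closed d_closed d_commute)

lemma pure_hom_left: "(\<lambda>k. pure k \<one>\<^bsub>L\<^esub>) \<in> ring_hom K tensor_ring"
  by (rule ring_hom_memI) (simp_all add: pure_tensors pure_mult pure_add_left)

lemma pure_hom_right: "(\<lambda>l. pure \<one> l) \<in> ring_hom L tensor_ring"
  by (rule ring_hom_memI) (simp_all add: pure_tensors pure_mult pure_add_right)

lemma tensor_one_not_zero: "pure \<one> \<one>\<^bsub>L\<^esub> \<noteq> op_zero"
proof -
  obtain f where f: "f \<in> duals" "f \<one> = \<one>\<^bsub>L\<^esub>" using dual_exists by blast
  then have "pure \<one> \<one>\<^bsub>L\<^esub> f \<one> \<noteq> op_zero f \<one>" by (simp add: op_apply)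
  then show ?thesis by metis
qed

section \<open>Linear combinations, independence over the constants and differential
  simplicity\<close>

fun combination :: "'a list \<Rightarrow> 'b list \<Rightarrow> ('a \<Rightarrow> 'b) \<Rightarrow> 'a \<Rightarrow> 'b" where
  "combination (k # ks) (l # ls) = pure k l [+] combination ks ls"
| "combination _ _ = op_zero"

fun constant_combination :: "'a list \<Rightarrow> 'b list \<Rightarrow> 'b" where
  "constant_combination (c # cs) (l # ls) = h c \<otimes>\<^bsub>L\<^esub> l \<oplus>\<^bsub>L\<^esub> constant_combination cs ls"
| "constant_combination _ _ = \<zero>\<^bsub>L\<^esub>"

definition const_span :: "'b list \<Rightarrow> 'b set" where
  "const_span ls = {constant_combination cs ls | cs. set cs \<subseteq> constants \<and> length cs = length ls}"

text \<open>Over a field, linear independence means that no entry lies in the span of the later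
  ones. This recursive form suits inductions that put one pure tensor in front.\<close>

fun independent :: "'b list \<Rightarrow> bool" where
  "independent (l # ls) \<longleftrightarrow> l \<notin> const_span ls \<and> independent ls"
| "independent [] \<longleftrightarrow> True"

lemma combination_closed:
  "\<lbrakk>length ks = length ls; set ks \<subseteq> carrier K; set ls \<subseteq> carrier L\<rbrakk> \<Longrightarrow> combination ks ls \<in> tensors"
  by (induction ks ls rule: list_induct2) (simp_all add: tensors.zero tensors.add)

lemma constant_combination_closed:
  "\<lbrakk>length cs = length ls; set cs \<subseteq> constants; set ls \<subseteq> carrier L\<rbrakk> \<Longrightarrow>
    constant_combination cs ls \<in> carrier L"
  by (induction cs ls rule: list_induct2) (simp_all add: h_simps)

lemma combination_constants:
  "\<lbrakk>length cs = length ls; set cs \<subseteq> constants; set ls \<subseteq> carrier L\<rbrakk> \<Longrightarrow>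
    combination cs ls = pure \<one> (constant_combination cs ls)"
proof (induction cs ls rule: list_induct2)
  case (Cons c cs l ls)
  then show ?case
    using pure_constant[of \<one> c l]
    by (simp add: pure_add_right h_simps constant_combination_closed constants_closed)
qed (simp add: pure_zero_right)

lemma combination_map_mult:
  "\<lbrakk>length ks = length ls; set ks \<subseteq> carrier K; set ls \<subseteq> carrier L; k \<in> carrier K\<rbrakk> \<Longrightarrow>
    combination (map ((\<otimes>) k) ks) ls = pure k \<one>\<^bsub>L\<^esub> [*] combination ks ls"
  by (induction ks ls rule: list_induct2)
    (simp_all add: tensors_mult_zero pure_tensors tensors_additive op_closed tensors_op
      combination_closed pure_mult)

lemma combination_map_d:
  "\<lbrakk>length ks = length ls; set ks \<subseteq> carrier K; set ls \<subseteq> carrier L\<rbrakk> \<Longrightarrow>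
    combination (map D ks) ls = op_d (combination ks ls)"
  by (induction ks ls rule: list_induct2)
    (simp_all add: op_d_zero op_d_add op_d_pure op_closed tensors_op combination_closed)

text \<open>A right factor that depends on \<open>ls\<close> is redistributed by moving its constant
  coefficients across the tensor sign; the coefficient at each entry of \<open>ls\<close> grows by
  \<open>k\<close> times the matching constant.\<close>

lemma combination_absorb:
  "\<lbrakk>length ks = length ls; length cs = length ls; set ks \<subseteq> carrier K; set ls \<subseteq> carrier L;
    set cs \<subseteq> constants; k \<in> carrier K\<rbrakk> \<Longrightarrow>
    \<exists>ks'. length ks' = length ls \<and> set ks' \<subseteq> carrier K \<and>
      pure k (constant_combination cs ls) [+] combination ks ls = combination ks' ls"
proof (induction ks ls arbitrary: cs rule: list_induct2)
  case Nil
  then show ?case by (simp add: pure_zero_right op_add_zero op_closed)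
next
  case (Cons k1 ks l ls)
  obtain c cs' where cs: "cs = c # cs'" using Cons.prems(1) by (cases cs) auto
  have "\<exists>ks'. length ks' = length ls \<and> set ks' \<subseteq> carrier K \<and>
      pure k (constant_combination cs' ls) [+] combination ks ls = combination ks' ls"
    by (rule Cons.IH) (use Cons.prems cs in auto)
  then obtain ks' where ks': "length ks' = length ls" "set ks' \<subseteq> carrier K"
    "pure k (constant_combination cs' ls) [+] combination ks ls = combination ks' ls" by blast
  have c: "c \<in> constants" "c \<in> carrier K" using Cons.prems cs constants_closed(1) by auto
  have cl: "constant_combination cs' ls \<in> carrier L" "combination ks ls \<in> operators"
    "l \<in> carrier L" "k1 \<in> carrier K" "k \<in> carrier K"
    using Cons cs constant_combination_closed[of cs' ls] combination_closed[of ks ls] tensors_op by auto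
  have "pure k (constant_combination cs (l # ls)) [+] combination (k1 # ks) (l # ls) =
    (pure (k \<otimes> c) l [+] pure k1 l) [+] (pure k (constant_combination cs' ls) [+] combination ks ls)"
    using cl c cs
    by (simp add: pure_add_right h_simps pure_constant op_closed op_add_assoc op_add_lcomm)
  also have "\<dots> = combination ((k \<otimes> c \<oplus> k1) # ks') (l # ls)"
    using cl c ks'(3) by (simp add: pure_add_left)
  finally show ?case
    using ks' cl c by (intro exI[of _ "(k \<otimes> c \<oplus> k1) # ks'"]) simp
qed

text \<open>Greedy choice: the right factor of a new summand either enlarges the independent list or
  is absorbed into the existing one.\<close>

lemma tensors_combination:
  assumes "u \<in> tensors"
  shows "\<exists>ks ls. length ks = length ls \<and> set ks \<subseteq> carrier K \<and> set ls \<subseteq> carrier L \<and>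
    independent ls \<and> u = combination ks ls"
  using assms
proof (induction rule: tensors.induct)
  case zero
  show ?case by (intro exI[of _ "[]"]) simp
next
  case (add k l u)
  then obtain ks ls where *: "length ks = length ls" "set ks \<subseteq> carrier K" "set ls \<subseteq> carrier L"
    "independent ls" "u = combination ks ls" by blast
  show ?case
  proof (cases "l \<in> const_span ls")
    case True
    then obtain cs where "l = constant_combination cs ls" "set cs \<subseteq> constants" "length cs = length ls"
      by (auto simp: const_span_def)
    with * add(1) show ?thesis using combination_absorb[of ks ls cs k] by metis
  next
    case False
    then show ?thesis
      using * add by (intro exI[of _ "k # ks"] exI[of _ "l # ls"]) simp
  qed
qed

text \<open>Normalising the leading coefficient to \<open>\<one>\<close> and differentiating shortens the combination;
  for \<open>I = 0\<close> this is the linear disjointness of \<open>L\<close> and \<open>K\<close> over the constants of \<open>K\<close>.\<close>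

lemma combination_in_ideal:
  assumes I: "ideal I tensor_ring" and dI: "\<And>u. u \<in> I \<Longrightarrow> op_d u \<in> I"
    and proper: "pure \<one> \<one>\<^bsub>L\<^esub> \<notin> I"
  shows "\<lbrakk>length ks = length ls; set ks \<subseteq> carrier K; set ls \<subseteq> carrier L; independent ls;
    combination ks ls \<in> I\<rbrakk> \<Longrightarrow> set ks \<subseteq> {\<zero>}"
proof (induction ls arbitrary: ks)
  case Nil
  then show ?case by simp
next
  case (Cons l ls)
  interpret I: ideal I tensor_ring by fact
  have mI: "u [*] v \<in> I" if "u \<in> tensors" "v \<in> I" for u v
    using I.I_l_closed that by simp
  obtain k ks' where ks: "ks = k # ks'" using Cons.prems(1) by (cases ks) auto
  have cl: "length ks' = length ls" "set ks' \<subseteq> carrier K" "set ls \<subseteq> carrier L" "k \<in> carrier K"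
    "l \<in> carrier L" "independent ls" "l \<notin> const_span ls"
    using Cons.prems ks by auto
  show ?case
  proof (cases "k = \<zero>")
    case True
    then have "combination ks' ls \<in> I"
      using Cons.prems ks cl True
      by (simp add: pure_zero_left op_add_zero tensors_op combination_closed)
    then show ?thesis using Cons.IH cl ks True by simp
  next
    case False
    then have i: "inv k \<in> carrier K" "inv k \<otimes> k = \<one>" using cl field_Units by auto
    define cs where "cs = map ((\<otimes>) (inv k)) ks'"
    have csK: "length cs = length ls" "set cs \<subseteq> carrier K" using cl i by (auto simp: cs_def)
    have "map ((\<otimes>) (inv k)) ks = \<one> # cs" using ks i by (simp add: cs_def)
    then have "combination (\<one> # cs) (l # ls) = pure (inv k) \<one>\<^bsub>L\<^esub> [*] combination ks (l # ls)"
      using combination_map_mult[of ks "l # ls" "inv k"] Cons.prems i by simp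
    then have 1: "combination (\<one> # cs) (l # ls) \<in> I"
      using mI Cons.prems i by (simp add: pure_tensors)
    \<comment> \<open>The leading coefficient \<open>\<one>\<close> has derivative
      \<open>\<zero>\<close>, so this element of the ideal is a combination of the shorter list
      \<open>ls\<close>, and the induction hypothesis makes every entry of \<open>cs\<close>
      constant.\<close>
    have "combination (map D (\<one> # cs)) (l # ls) \<in> I"
      using combination_map_d[of "\<one> # cs" "l # ls"] dI[OF 1] csK cl by simp
    moreover have "set (map D cs) \<subseteq> carrier K" using csK d_closed by auto
    ultimately have "combination (map D cs) ls \<in> I"
      using csK cl combination_closed[of "map D cs" ls]
      by (simp add: d_one pure_zero_left op_add_zero tensors_op)
    then have "set (map D cs) \<subseteq> {\<zero>}"
      using Cons.IH[of "map D cs"] csK cl d_closed by auto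
    then have cs: "set cs \<subseteq> constants" using csK by (auto simp: constants_def)
    let ?y = "constant_combination cs ls"
    have y: "?y \<in> carrier L" using constant_combination_closed csK cs cl by blast
    \<comment> \<open>With constant coefficients the whole combination collapses into one pure
      tensor from L. As L is a field, it is a unit of the tensor ring unless it vanishes. A unit
      contradicts properness of the ideal, and vanishing puts \<open>l\<close> into the span of
      \<open>ls\<close>.\<close>
    have in_I: "pure \<one> (l \<oplus>\<^bsub>L\<^esub> ?y) \<in> I"
      using 1 combination_constants[of cs ls] csK cs cl y by (simp add: pure_add_right)
    have "l \<oplus>\<^bsub>L\<^esub> ?y = \<zero>\<^bsub>L\<^esub>"
    proof (rule ccontr)
      assume nz: "l \<oplus>\<^bsub>L\<^esub> ?y \<noteq> \<zero>\<^bsub>L\<^esub>"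
      let ?z = "inv\<^bsub>L\<^esub> (l \<oplus>\<^bsub>L\<^esub> ?y)"
      have z: "?z \<in> carrier L" "?z \<otimes>\<^bsub>L\<^esub> (l \<oplus>\<^bsub>L\<^esub> ?y) = \<one>\<^bsub>L\<^esub>"
        using nz y cl L.field_Units by auto
      have "pure \<one> ?z [*] pure \<one> (l \<oplus>\<^bsub>L\<^esub> ?y) = pure \<one> \<one>\<^bsub>L\<^esub>"
        using z y cl by (simp add: pure_mult)
      then show False using mI[OF _ in_I, of "pure \<one> ?z"] proper z by (simp add: pure_tensors)
    qed
    then have l: "l = \<ominus>\<^bsub>L\<^esub> ?y" using cl y by (simp add: L.minus_equality)
    have "\<ominus>\<^bsub>L\<^esub> constant_combination cs ls = constant_combination (map (\<lambda>c. \<ominus> c) cs) ls"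
      using csK(1) cs cl(3)
    proof (induction cs ls rule: list_induct2)
      case (Cons c cs l ls)
      then show ?case
        by (simp add: h_minus h_simps L.minus_add L.l_minus constant_combination_closed)
    qed simp
    moreover have "set (map (\<lambda>c. \<ominus> c) cs) \<subseteq> constants"
      using cs constants_closed(6) by auto
    ultimately have "l \<in> const_span ls"
      using l csK unfolding const_span_def by (metis (mono_tags, lifting) length_map mem_Collect_eq)
    then show ?thesis using cl by blast
  qed
qed

lemma tensor_ring_simple:
  assumes "ideal I tensor_ring" "\<And>u. u \<in> I \<Longrightarrow> op_d u \<in> I" "pure \<one> \<one>\<^bsub>L\<^esub> \<notin> I"
  shows "I \<subseteq> {op_zero}"
proof
  fix u assume u: "u \<in> I"
  interpret I: ideal I tensor_ring by fact
  have "u \<in> tensors" using u I.Icarr by simp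
  then obtain ks ls where *: "length ks = length ls" "set ks \<subseteq> carrier K" "set ls \<subseteq> carrier L"
    "independent ls" "u = combination ks ls" using tensors_combination by blast
  then have zero: "set ks \<subseteq> {\<zero>}" using combination_in_ideal[OF assms] u by blast
  have "combination ks ls = op_zero"
    using *(1,3) zero
    by (induction ks ls rule: list_induct2) (simp_all add: pure_zero_left op_add_zero op_closed)
  then show "u \<in> {op_zero}" using * by simp
qed

lemma domain_tensor_ring: "domain tensor_ring"
proof (rule T.domain_of_simple)
  show "\<one>\<^bsub>tensor_ring\<^esub> \<noteq> \<zero>\<^bsub>tensor_ring\<^esub>" using tensor_one_not_zero by simp
  show "I \<subseteq> {\<zero>\<^bsub>tensor_ring\<^esub>}"
    if "ideal I tensor_ring" "\<And>x. x \<in> I \<Longrightarrow> op_d x \<in> I" "\<one>\<^bsub>tensor_ring\<^esub> \<notin> I" for I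
    using tensor_ring_simple that by simp
  fix n u assume u: "u \<in> carrier tensor_ring" "add_pow tensor_ring (Suc n) u = \<zero>\<^bsub>tensor_ring\<^esub>"
  \<comment> \<open>The integer is a unit of K, hence of the tensor ring, and can be cancelled
    there.\<close>
  define k where "k = add_pow K (Suc n) \<one>"
  have k: "k \<in> carrier K" "k \<noteq> \<zero>" using char_zero[of "Suc n"] by (simp_all add: k_def)
  then have i: "inv k \<in> carrier K" "inv k \<otimes> k = \<one>" using field_Units by auto
  have "pure k \<one>\<^bsub>L\<^esub> [*] u = add_pow tensor_ring (Suc n) \<one>\<^bsub>tensor_ring\<^esub> \<otimes>\<^bsub>tensor_ring\<^esub> u"
    unfolding k_def ring_hom_add_pow[OF ring_axioms T.ring_axioms pure_hom_left one_closed] by simp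
  also have "\<dots> = add_pow tensor_ring (Suc n) u"
    using T.add_pow_ldistr[of "\<one>\<^bsub>tensor_ring\<^esub>" u "Suc n"] u
    by (simp add: pure_tensors pure_one_mult tensors_op del: T.add.nat_pow_Suc)
  finally have "pure (inv k) \<one>\<^bsub>L\<^esub> [*] (pure k \<one>\<^bsub>L\<^esub> [*] u) = op_zero"
    using u i by (simp add: tensors_mult_zero pure_tensors)
  moreover have "pure (inv k) \<one>\<^bsub>L\<^esub> [*] (pure k \<one>\<^bsub>L\<^esub> [*] u) = u"
    using u i k by (simp add: op_mult_assoc[symmetric] op_closed tensors_op pure_mult pure_one_mult)
  ultimately show "u = \<zero>\<^bsub>tensor_ring\<^esub>" by simp
qed

sublocale T: difference_differential_domain tensor_ring op_s op_d
proof -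
  interpret T: "domain" tensor_ring by (rule domain_tensor_ring)
  show "difference_differential_domain tensor_ring op_s op_d"
    by unfold_locales (simp_all add: op_s_iso op_d_s_commute)
qed

section \<open>The common extension of K and L\<close>

abbreviation "compositum \<equiv> fraction_field tensor_ring"

definition embed_left :: "'a \<Rightarrow> ((('a \<Rightarrow> 'b) \<Rightarrow> 'a \<Rightarrow> 'b) \<times> (('a \<Rightarrow> 'b) \<Rightarrow> 'a \<Rightarrow> 'b)) set" where
  "embed_left k = ring_frac tensor_ring (pure k \<one>\<^bsub>L\<^esub>) \<one>\<^bsub>tensor_ring\<^esub>"

definition embed_right :: "'b \<Rightarrow> ((('a \<Rightarrow> 'b) \<Rightarrow> 'a \<Rightarrow> 'b) \<times> (('a \<Rightarrow> 'b) \<Rightarrow> 'a \<Rightarrow> 'b)) set" where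
  "embed_right l = ring_frac tensor_ring (pure \<one> l) \<one>\<^bsub>tensor_ring\<^esub>"

lemma embed_left_hom: "embed_left \<in> ring_hom K compositum"
  using ring_hom_trans[OF pure_hom_left T.frac_hom] by (simp add: comp_def embed_left_def[abs_def])

lemma embed_right_hom: "embed_right \<in> ring_hom L compositum"
  using ring_hom_trans[OF pure_hom_right T.frac_hom] by (simp add: comp_def embed_right_def[abs_def])

lemma embed_left_s: "k \<in> carrier K \<Longrightarrow> T.frac_s (embed_left k) = embed_left (\<sigma> k)"
  using T.frac_s_of[of "pure k \<one>\<^bsub>L\<^esub>"] by (simp add: embed_left_def pure_tensors op_s_pure L.s_one)

lemma embed_left_d: "k \<in> carrier K \<Longrightarrow> T.frac_d (embed_left k) = embed_left (D k)"
  using T.frac_d_of[of "pure k \<one>\<^bsub>L\<^esub>"] by (simp add: embed_left_def pure_tensors op_d_pure)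

lemma embed_right_s: "l \<in> carrier L \<Longrightarrow> T.frac_s (embed_right l) = embed_right (\<tau> l)"
  using T.frac_s_of[of "pure \<one> l"] by (simp add: embed_right_def pure_tensors op_s_pure s_one)

lemma embed_right_d: "l \<in> carrier L \<Longrightarrow> T.frac_d (embed_right l) = \<zero>\<^bsub>compositum\<^esub>"
  using T.frac_d_of[of "pure \<one> l"] T.fraction_zero
  by (simp add: embed_right_def pure_tensors op_d_pure d_one pure_zero_left)

text \<open>The balancing relation with both factors equal to one. It ensures that a parameter from
  the constants names the same element of the compositum whether it arrives through K or through
  L.\<close>

lemma embed_constant: "c \<in> constants \<Longrightarrow> embed_left c = embed_right (h c)"
  using pure_constant[of \<one> c "\<one>\<^bsub>L\<^esub>"] h_simps(1) constants_closed(1)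
  by (simp add: embed_left_def embed_right_def)

lemma compositum_dd_field: "difference_differential_field compositum T.frac_s T.frac_d"
proof -
  interpret F: differential_ring compositum T.frac_d by (rule T.frac_d_axioms)
  show ?thesis
    by (intro field_char_zero_hom[OF field_char_zero_axioms T.field_fraction_field embed_left_hom]
        difference_differential_field.intro difference_field.intro difference_field_axioms.intro
        difference_differential_field_axioms.intro T.frac_s_iso F.d_closed F.d_add F.d_mult
        T.frac_commute)
qed

end

section \<open>Models of ACFA\<close>

theorem proposition2p3p1:
  fixes K :: "'a ring" and \<sigma> D :: "'a \<Rightarrow> 'a"
  assumes "DCFA_model TYPE('a) K \<sigma> D"
  shows "ACFA_model TYPE('b) (constant_field K D) \<sigma>"
  unfolding ACFA_model_def
proof (intro conjI allI impI)
  interpret K: difference_differential_field K \<sigma> D using assms by (simp add: DCFA_model_def)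
  let ?C = "constant_field K D"
  interpret C: difference_field ?C \<sigma>
    using K.difference_field_constants by (simp add: constant_field_def K.constants_def)
  show "difference_field ?C \<sigma>" by (rule C.difference_field_axioms)
  fix L :: "'b ring" and \<tau> h
  assume "difference_field L \<tau>"
    and h: "op_embedding ?C (case_difference_symbol \<sigma>) L (case_difference_symbol \<tau>) h"
  then interpret L: difference_field L \<tau> by simp
  have C_closed: "case_difference_symbol \<sigma> u x \<in> carrier ?C" if "x \<in> carrier ?C" for u x
    using that C.s_closed by (cases u) simp
  have hom: "h \<in> ring_hom ?C L" using h by (simp add: op_embedding_def)
  have h_commute: "h (\<sigma> c) = \<tau> (h c)" if "c \<in> carrier ?C" for c
    using h that unfolding op_embedding_def by (metis difference_symbol.case)
  interpret E: constant_extension K \<sigma> D L \<tau> h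
    by unfold_locales (use hom h_commute in \<open>auto simp: constant_field_def\<close>)
  define F where "F = E.compositum"
  let ?I = "case_difference_differential_symbol \<sigma> D"
  let ?J = "case_difference_differential_symbol E.T.frac_s E.T.frac_d"
  interpret F: difference_differential_field F E.T.frac_s E.T.frac_d
    unfolding F_def by (rule E.compositum_dd_field)
  let ?i = E.embed_left and ?j = E.embed_right
  have i: "op_embedding K ?I F ?J ?i"
    using E.embed_left_hom
    by (auto simp: op_embedding_def F_def E.embed_left_s E.embed_left_d
        split: difference_differential_symbol.split)
  \<comment> \<open>Interpreting every difference symbol by \<open>DD_Sigma_sym\<close> forgets the
    derivation, so \<open>?j\<close> is an embedding into the underlying difference field of
    \<open>F\<close>.\<close>
  have j: "op_embedding L (case_difference_symbol \<tau>) F (\<lambda>u. ?J DD_Sigma_sym) ?j"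
    using E.embed_right_hom
    by (auto simp: op_embedding_def F_def E.embed_right_s split: difference_symbol.split)
  have jd: "E.T.frac_d (?j l) = \<zero>\<^bsub>F\<^esub>" if "l \<in> carrier L" for l
    using E.embed_right_d that by (simp add: F_def)
  have ij: "?i c = ?j (h c)" if "c \<in> carrier ?C" for c
    using E.embed_constant that by (simp add: K.constants_def constant_field_def)
  have j_inj: "inj_on ?j (carrier L)"
    using non_trivial_field_hom_is_inj[OF _ L.field_axioms F.field_axioms] j
    by (auto simp: op_embedding_def)
  show "ec_in ?C (case_difference_symbol \<sigma>) L (case_difference_symbol \<tau>) h"
    unfolding ec_in_def
  proof (intro allI impI)
    fix \<phi> :: "(difference_symbol, nat + nat) qf" and a :: "nat \<Rightarrow> 'a"
    assume a: "range a \<subseteq> carrier ?C"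
      and "\<exists>b. range b \<subseteq> carrier L \<and> qf_sat L (case_difference_symbol \<tau>) (case_sum (h \<circ> a) b) \<phi>"
    then obtain b where b: "range b \<subseteq> carrier L"
      "qf_sat L (case_difference_symbol \<tau>) (case_sum (h \<circ> a) b) \<phi>" by blast
    have aK: "range a \<subseteq> carrier K" using a by (auto simp: constant_field_def)
    \<comment> \<open>Only the existential variables that occur in the formula can be forced to be
      constant, as a formula holds finitely many equations.\<close>
    obtain ns where ns: "set ns = {n. Inr n \<in> set2_qf \<phi>}"
      using finite_list[of "Inr -` set2_qf \<phi>"] finite_vimageI[OF finite_set2_qf[of \<phi>], of Inr]
      by (auto simp: vimage_def)
    define \<phi>' where "\<phi>' = map_qf (\<lambda>_. DD_Sigma_sym) id \<phi>"
    define \<psi> :: "(difference_differential_symbol, nat + nat) qf"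
      where "\<psi> = foldr (\<lambda>n. Conj (Equal (Op DD_D_sym (Var (Inr n))) Zero)) ns \<phi>'"
    \<comment> \<open>Stated for an arbitrary structure, since it is used to establish the formula
      in \<open>F\<close> and to read it off in K.\<close>
    have \<psi>: "qf_sat R J e \<psi> \<longleftrightarrow>
        (\<forall>n\<in>set ns. J DD_D_sym (e (Inr n)) = \<zero>\<^bsub>R\<^esub>) \<and> qf_sat R (\<lambda>u. J DD_Sigma_sym) e \<phi>"
      for R :: "'z ring" and J e
    proof -
      have "qf_sat R J e (foldr (\<lambda>n. Conj (Equal (Op DD_D_sym (Var (Inr n))) Zero)) ns \<phi>') \<longleftrightarrow>
        (\<forall>n\<in>set ns. J DD_D_sym (e (Inr n)) = \<zero>\<^bsub>R\<^esub>) \<and> qf_sat R J e \<phi>'" for ns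
        by (induction ns) auto
      then show ?thesis by (simp add: \<psi>_def \<phi>'_def qf_sat_map)
    qed
    have L_closed: "case_difference_symbol \<tau> u x \<in> carrier L" if "x \<in> carrier L" for u x
      using that L.s_closed by (cases u) simp
    have "range (case_sum (h \<circ> a) b) \<subseteq> carrier L"
      using a b ring_hom_closed[OF hom] by (auto simp: image_subset_iff split: sum.splits)
    then have "qf_sat F (\<lambda>u. ?J DD_Sigma_sym) (?j \<circ> case_sum (h \<circ> a) b) \<phi>"
      using qf_sat_embedding[OF L.ring_axioms F.ring_axioms j L_closed _ j_inj] b(2) by blast
    moreover have "?j \<circ> case_sum (h \<circ> a) b = case_sum (?i \<circ> a) (?j \<circ> b)"
      using a ij by (auto simp: fun_eq_iff image_subset_iff split: sum.splits)
    ultimately have "qf_sat F ?J (case_sum (?i \<circ> a) (?j \<circ> b)) \<psi>"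
      using b(1) jd by (auto simp: \<psi>)
    moreover have "range (?j \<circ> b) \<subseteq> carrier F"
      using b(1) j ring_hom_closed[of ?j L F] by (auto simp: op_embedding_def)
    ultimately have "\<exists>c. range c \<subseteq> carrier K \<and> qf_sat K ?I (case_sum a c) \<psi>"
      by (intro ec_inD[OF DCFA_model_ec_in[OF assms F.difference_differential_field_axioms i] aK])
    then obtain c where c: "range c \<subseteq> carrier K" "qf_sat K ?I (case_sum a c) \<psi>" by blast
    \<comment> \<open>Values at variables outside the formula carry no equation and need not be
      constant. They are replaced by \<open>\<zero>\<close>, which is constant, without affecting
      satisfaction.\<close>
    define c' where "c' n = (if n \<in> set ns then c n else \<zero>\<^bsub>K\<^esub>)" for n
    have c': "range c' \<subseteq> carrier ?C"
      using c by (auto simp: c'_def \<psi> constant_field_def K.d_zero image_subset_iff)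
    have "qf_sat K (\<lambda>u. ?I DD_Sigma_sym) (case_sum a c) \<phi>" using c(2) by (simp add: \<psi>)
    moreover have "case_sum a c v = (id \<circ> case_sum a c') v" if "v \<in> set2_qf \<phi>" for v
      using that ns by (cases v rule: sum.exhaust) (auto simp: c'_def)
    ultimately have sat: "qf_sat K (\<lambda>u. ?I DD_Sigma_sym) (id \<circ> case_sum a c') \<phi>"
      using qf_sat_cong[of \<phi> "case_sum a c" "id \<circ> case_sum a c'"] by simp
    \<comment> \<open>The inclusion of the constants in the difference field underlying K reflects
      quantifier-free formulas, which brings the solution down to \<open>?C\<close>.\<close>
    have CK: "op_embedding ?C (case_difference_symbol \<sigma>) K (\<lambda>u. ?I DD_Sigma_sym) id"
      by (auto simp: op_embedding_def ring_hom_def constant_field_def split: difference_symbol.split)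
    have ac': "range (case_sum a c') \<subseteq> carrier ?C"
      using a c' by (auto simp: image_subset_iff split: sum.splits)
    have "qf_sat ?C (case_difference_symbol \<sigma>) (case_sum a c') \<phi>"
      using qf_sat_embedding[OF C.ring_axioms K.ring_axioms CK C_closed ac'] sat by simp
    then show "\<exists>c. range c \<subseteq> carrier ?C \<and> qf_sat ?C (case_difference_symbol \<sigma>) (case_sum a c) \<phi>"
      using c' by blast
  qed
qed

end
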